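(* (i) Let $F=\{(f_1,g_1),\dots,(f_k,g_k)\}$ be a system of min-plus polynomials in $n$ variables over the semiring $\mathbb{R}$, let $d_i$ be the degree of $(f_i,g_i)$, and let $N=(n+2)(d_1+\dots+d_k)$. Then $F$ has a root in $\mathbb{R}^n$ if and only if the Macaulay min-plus linear system $\mathit{Ml}_N\odot\vec y=\mathit{Mr}_N\odot\vec y$ has a solution over $\mathbb{R}$. (ii) There is a fixed polynomial $p$ with the following property. Let $F=\{(f_1,g_1),\dots,(f_k,g_k)\}$ be any system of min-plus polynomials in $n$ variables over the semiring $\mathbb{R}_\infty$, let $d$ be the maximum of the degrees of the $(f_i,g_i)$, and let $N=p(n,k,d)\,(4d)^{\min(n,k)}$. Then $F$ has a root in $\mathbb{R}_\infty^n$ if and only if the non-homogeneous Macaulay min-plus linear system $\mathit{Ml}_N\odot(0,\vec y)=\mathit{Mr}_N\odot(0,\vec y)$ has a solution over $\mathbb{R}_\infty$.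
   Context: $\mathbb{R}_\infty=\mathbb{R}\cup\{+\infty\}$. Tropical operations on $\mathbb{K}\in\{\mathbb{R},\mathbb{R}_\infty\}$: $x\oplus y=\min\{x,y\}$, $x\odot y=x+y$. A tropical monomial is $m(\vec x)=c\odot \vec x^{I}$ with $c\in\mathbb{K}$, $I=(i_1,\dots,i_n)\in\mathbb{Z}_{\ge0}^n$ and $\vec x^{I}=i_1x_1+\dots+i_nx_n$ in classical notation (with $0\cdot\infty=0$); its degree is $|I|=i_1+\dots+i_n$. A tropical polynomial is a finite tropical sum $f=\min_i m_i$ of monomials with pairwise distinct exponent vectors; its degree is the maximal degree of its monomials. A min-plus polynomial is a pair $(f,g)$ of tropical polynomials; its degree is $\max(\deg f,\deg g)$; a point $\vec a\in\mathbb{K}^n$ is a root of $(f,g)$ if $f(\vec a)=g(\vec a)$. A root of a system is a common root of all its members. Macaulay matrices: the infinite matrices $\mathit{Ml}$ and $\mathit{Mr}$ have columns indexed by $I\in\mathbb{Z}_{\ge0}^n$ and rows indexed by pairs $(j,J)$, $1\le j\le k$, $J\in\mathbb{Z}_{\ge0}^n$; the entry of $\mathit{Ml}$ (resp. $\mathit{Mr}$) in row $(j,J)$ and column $I$ is the coefficient of $\vec x^I$ in $\vec x^J\odot f_j$ (resp. $\vec x^J\odot g_j$), equal to $\infty$ if there is no such monomial. $\mathit{Ml}_N,\mathit{Mr}_N$ are the submatrices consisting of the columns $I$ with $|I|\le N$ and of those rows $(j,J)$ such that all finite entries of row $(j,J)$ in both $\mathit{Ml}$ and $\mathit{Mr}$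 lie in these columns. For a matrix $A=(a_{ij})$ over $\mathbb{R}_\infty$, $A\odot\vec y$ is the vector with coordinates $\min_j(a_{ij}+y_j)$. Over $\mathbb{R}$ a solution $\vec y$ of $\mathit{Ml}_N\odot\vec y=\mathit{Mr}_N\odot\vec y$ must have all coordinates finite. Over $\mathbb{R}_\infty$, a solution of the non-homogeneous system is a solution with coordinates in $\mathbb{R}_\infty$ whose coordinate corresponding to $I=\vec0$ (the constant monomial) equals $0$. *)

theory Defs
  imports Main "HOL-Library.Extended_Real" "HOL-Computational_Algebra.Polynomial"
begin

text \<open>
  The two tropical semirings are carriers inside \<^typ>\<open>ereal\<close>: tropical addition is \<^const>\<open>min\<close>,
  tropical multiplication is addition of \<^typ>\<open>ereal\<close>. The value \<open>-\<infinity>\<close> belongs to neither carrier.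
\<close>

definition trop_real :: "ereal set" where
  "trop_real = range ereal"

definition trop_real_inf :: "ereal set" where
  "trop_real_inf = insert \<infinity> (range ereal)"

text \<open>
  The number \<open>n\<close> of variables is an ordinary natural number; the variables are numbered from \<open>0\<close>.
  Exponent vectors are functions vanishing from index \<open>n\<close> on, so that equality of exponent vectors
  is equality of functions, and \<open>\<le>\<close> and \<open>-\<close> on them are pointwise.
\<close>

type_synonym expo = "nat \<Rightarrow> nat"

definition expos :: "nat \<Rightarrow> expo set" where
  "expos n = {I. \<forall>i\<ge>n. I i = 0}"

definition expo_degree :: "nat \<Rightarrow> expo \<Rightarrow> nat" where
  "expo_degree n I = (\<Sum>i<n. I i)"

text \<open>In \<^typ>\<open>ereal\<close> one has \<open>0 * \<infinity> = 0\<close>, which is the convention needed here.\<close>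

definition expo_eval :: "nat \<Rightarrow> expo \<Rightarrow> (nat \<Rightarrow> ereal) \<Rightarrow> ereal" where
  "expo_eval n I x = (\<Sum>i<n. ereal (real (I i)) * x i)"

text \<open>
  A tropical polynomial is a finite nonempty family of monomials with distinct exponent vectors:
  \<open>f I = Some c\<close> means that \<open>f\<close> has the monomial with coefficient \<open>c\<close> and exponent \<open>I\<close>.
  Over the semiring with infinity, \<open>c = \<infinity>\<close> is allowed; such a monomial counts for the degree.
\<close>

type_synonym trop_poly = "expo \<rightharpoonup> ereal"

definition is_trop_poly :: "ereal set \<Rightarrow> nat \<Rightarrow> trop_poly \<Rightarrow> bool" where
  "is_trop_poly K n f \<longleftrightarrow> finite (dom f) \<and> dom f \<noteq> {} \<and> dom f \<subseteq> expos n \<and> ran f \<subseteq> K"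

definition trop_eval :: "nat \<Rightarrow> trop_poly \<Rightarrow> (nat \<Rightarrow> ereal) \<Rightarrow> ereal" where
  "trop_eval n f x = Min ((\<lambda>I. the (f I) + expo_eval n I x) ` dom f)"

definition trop_degree :: "nat \<Rightarrow> trop_poly \<Rightarrow> nat" where
  "trop_degree n f = Max (expo_degree n ` dom f)"

definition trop_coeff :: "trop_poly \<Rightarrow> expo \<Rightarrow> ereal" where
  "trop_coeff f I = (case f I of None \<Rightarrow> \<infinity> | Some c \<Rightarrow> c)"

text \<open>Tropical product of the monomial with exponent \<open>J\<close> and coefficient \<open>0\<close> with \<open>f\<close>.\<close>

definition trop_shift :: "expo \<Rightarrow> trop_poly \<Rightarrow> trop_poly" where
  "trop_shift J f = (\<lambda>I. if J \<le> I then f (I - J) else None)"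

type_synonym minplus_poly = "trop_poly \<times> trop_poly"

definition minplus_degree :: "nat \<Rightarrow> minplus_poly \<Rightarrow> nat" where
  "minplus_degree n P = max (trop_degree n (fst P)) (trop_degree n (snd P))"

definition minplus_system :: "ereal set \<Rightarrow> nat \<Rightarrow> minplus_poly list \<Rightarrow> bool" where
  "minplus_system K n F \<longleftrightarrow>
     (\<forall>P\<in>set F. is_trop_poly K n (fst P) \<and> is_trop_poly K n (snd P))"

text \<open>The \<open>0\<close> only serves to fix the value for the empty system.\<close>

definition max_degree :: "nat \<Rightarrow> minplus_poly list \<Rightarrow> nat" where
  "max_degree n F = Max (insert 0 (minplus_degree n ` set F))"

definition system_root :: "ereal set \<Rightarrow> nat \<Rightarrow> minplus_poly list \<Rightarrow> (nat \<Rightarrow> ereal) \<Rightarrow> bool" where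
  "system_root K n F x \<longleftrightarrow>
     (\<forall>i<n. x i \<in> K) \<and> (\<forall>P\<in>set F. trop_eval n (fst P) x = trop_eval n (snd P) x)"

definition Ml :: "minplus_poly list \<Rightarrow> nat \<times> expo \<Rightarrow> expo \<Rightarrow> ereal" where
  "Ml F r I = trop_coeff (trop_shift (snd r) (fst (F ! fst r))) I"

definition Mr :: "minplus_poly list \<Rightarrow> nat \<times> expo \<Rightarrow> expo \<Rightarrow> ereal" where
  "Mr F r I = trop_coeff (trop_shift (snd r) (snd (F ! fst r))) I"

text \<open>
  The truncated matrices are \<^const>\<open>Ml\<close> and \<^const>\<open>Mr\<close> restricted to the following
  columns and rows; an entry is finite iff it differs from \<open>\<infinity>\<close>.
\<close>

definition mac_cols :: "nat \<Rightarrow> nat \<Rightarrow> expo set" where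
  "mac_cols n N = {I \<in> expos n. expo_degree n I \<le> N}"

definition mac_rows :: "nat \<Rightarrow> minplus_poly list \<Rightarrow> nat \<Rightarrow> (nat \<times> expo) set" where
  "mac_rows n F N = {r \<in> {..<length F} \<times> expos n.
     \<forall>I\<in>expos n. Ml F r I \<noteq> \<infinity> \<or> Mr F r I \<noteq> \<infinity> \<longrightarrow> I \<in> mac_cols n N}"

definition trop_mat_vec :: "'c set \<Rightarrow> ('r \<Rightarrow> 'c \<Rightarrow> ereal) \<Rightarrow> ('c \<Rightarrow> ereal) \<Rightarrow> 'r \<Rightarrow> ereal" where
  "trop_mat_vec C A y r = Min ((\<lambda>c. A r c + y c) ` C)"

definition mac_solution ::
    "ereal set \<Rightarrow> nat \<Rightarrow> minplus_poly list \<Rightarrow> nat \<Rightarrow> (expo \<Rightarrow> ereal) \<Rightarrow> bool" where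
  "mac_solution K n F N y \<longleftrightarrow>
     (\<forall>I\<in>mac_cols n N. y I \<in> K) \<and>
     (\<forall>r\<in>mac_rows n F N.
        trop_mat_vec (mac_cols n N) (Ml F) y r = trop_mat_vec (mac_cols n N) (Mr F) y r)"

definition mac_nonhom_solution ::
    "ereal set \<Rightarrow> nat \<Rightarrow> minplus_poly list \<Rightarrow> nat \<Rightarrow> (expo \<Rightarrow> ereal) \<Rightarrow> bool" where
  "mac_nonhom_solution K n F N y \<longleftrightarrow> mac_solution K n F N y \<and> y (\<lambda>_. 0) = 0"

text \<open>
  Polynomials in three variables, as iterated univariate polynomials; the natural coefficients make
  the value a natural number.
\<close>

definition poly3 :: "nat poly poly poly \<Rightarrow> nat \<Rightarrow> nat \<Rightarrow> nat \<Rightarrow> nat" where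
  "poly3 p a b c = poly (poly (poly p [:[:a:]:]) [:b:]) c"

end

theory Submission
  imports Defs "HOL-Analysis.Function_Topology"
begin

text \<open>
A root \<open>x\<close> gives the solution \<open>y\<^sub>I = x\<^sup>I\<close>, because row \<open>(j, J)\<close> then reads
\<open>x\<^sup>J \<odot> f\<^sub>j(x) = x\<^sup>J \<odot> g\<^sub>j(x)\<close>. The content of the theorem is the converse.

Over the reals, let \<open>y\<close> solve the system. Regard every monomial of \<open>f\<^sub>j\<close> and of \<open>g\<^sub>j\<close>, with coefficient
\<open>c\<^sub>e\<close> and exponent \<open>u\<^sub>e\<close>, as a generator of group \<open>j\<close>, and minimise \<open>y\<^sub>K + (\<Sum>e. w\<^sub>e * c\<^sub>e)\<close> over all columns
\<open>K\<close> and all real weights \<open>w \<ge> 0\<close> with \<open>(\<Sum>e. w\<^sub>e * u\<^sub>e) = K\<close> and total weight \<open>n + 2\<close> in every group. Take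
an optimum whose support is as large as possible. Linear programming duality in its strictly
complementary form provides slopes \<open>a\<close> and offsets \<open>b\<close> with \<open>c\<^sub>e + a \<bullet> u\<^sub>e \<ge> b\<^sub>j\<close> for \<open>e\<close> in group \<open>j\<close>, and
equality exactly on the support. So \<open>b\<^sub>j\<close> is the smaller of \<open>f\<^sub>j(a)\<close> and \<open>g\<^sub>j(a)\<close>, and the support consists
of the monomials that attain it. Suppose that they all belong to \<open>f\<^sub>j\<close>. By Caratheodory's
argument the weight \<open>n + 2\<close> of group \<open>j\<close> can be carried by at most \<open>n + 1\<close> monomials, so that some
\<open>v\<close> in the support can be given weight more than \<open>1\<close>. The Macaulay equation of row \<open>K - u\<^sub>v\<close> yields a
monomial \<open>e\<close> of \<open>g\<^sub>j\<close> with \<open>y\<^bsub>K - u v + u e\<^esub> + c\<^sub>e \<le> y\<^sub>K + c\<^sub>v\<close>. Trading one unit of \<open>v\<close> for one unit of \<open>e\<close>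
gives another optimum, whose support contains \<open>e\<close> in addition: a contradiction. Hence \<open>a\<close> is a root.
The total weight \<open>n + 2\<close> is the source of the degree \<open>(n + 2) * (d\<^sub>1 + \<dots> + d\<^sub>k)\<close>.

Over the semiring with infinity only \<open>y\<^sub>0\<close> is known to be finite, so the minimisation has to start
at \<open>K = 0\<close>. To make this feasible, every group gets an additional generator of exponent \<open>0\<close> with a huge
cost \<open>\<kappa>\<close>, and every variable a generator outside the groups, its unit vector, with cost
\<open>\<tau>\<close>. The latter forces \<open>a\<^sub>i \<ge> - \<tau>\<close> and bounds the degree of the optimal \<open>K\<close>. Compare the \<open>a\<^sub>i\<close> with
the thresholds \<open>\<sigma>\<^sub>q = \<tau> * (4 * d) ^ q\<close>. The set of variables up to \<open>\<sigma>\<^sub>q\<close> grows with \<open>q\<close>, and so does the set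
of pairs \<open>(f\<^sub>j, g\<^sub>j)\<close> with a monomial in these variables only. The chain with the smaller
number of possible elements repeats at some \<open>q \<le> min n k\<close>, and in either case the set of pairs is the same for \<open>q\<close> and \<open>q + 1\<close>.
For this \<open>q\<close>, set to infinity all variables above \<open>\<sigma>\<^bsub>q+1\<^esub>\<close>.
A pair without a monomial in the remaining variables becomes \<open>\<infinity> = \<infinity>\<close>.
For any other pair the minimum is at most \<open>\<tau> + d * \<sigma>\<^sub>q\<close>, which is less than \<open>\<kappa>\<close> and less than the value
of every monomial that contains a variable above \<open>\<sigma>\<^bsub>q+1\<^esub> = 4 * d * \<sigma>\<^sub>q\<close>; so the exchange argument
applies, and the change of the variables does not affect the minimum.

The lemmas that carry the proof are \<open>equality_strictness_alternative\<close> (duality),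
\<open>concentrate_weights\<close> (Caratheodory), \<open>exchange_stable_generators\<close> (the optimisation),
\<open>macaulay_exchange\<close> (the use of the equations), and the two theorems \<open>root_of_real_solution\<close> and
\<open>root_of_infinity_solution\<close>.
\<close>

section \<open>Linear inequalities: a transposition theorem\<close>

text \<open>
A triple \<open>(M, c, s)\<close> encodes the inequality \<open>(\<Sum>r. l r * M r) + c \<ge> 0\<close> in the unknown \<open>l\<close>, which is strict
if \<open>s\<close> holds. The cone consists of the consequences obtained by adding and scaling. It is defined
inductively, and not by coefficients, so that eliminating a variable replaces a set of
inequalities by a subset of its cone without any change of index type.
\<close>

inductive_set ineq_cone :: "(('r \<Rightarrow> real) \<times> real \<times> bool) set \<Rightarrow> (('r \<Rightarrow> real) \<times> real \<times> bool) set"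
  for X where
  base: "x \<in> X \<Longrightarrow> x \<in> ineq_cone X"
| add: "(M, c, s) \<in> ineq_cone X \<Longrightarrow> (M', c', s') \<in> ineq_cone X \<Longrightarrow>
    (\<lambda>r. M r + M' r, c + c', s \<or> s') \<in> ineq_cone X"
| scale: "(M, c, s) \<in> ineq_cone X \<Longrightarrow> t > 0 \<Longrightarrow> (\<lambda>r. t * M r, t * c, s) \<in> ineq_cone X"

definition ineq_holds :: "'r set \<Rightarrow> ('r \<Rightarrow> real) \<Rightarrow> ('r \<Rightarrow> real) \<times> real \<times> bool \<Rightarrow> bool" where
  "ineq_holds R l x \<longleftrightarrow> (case x of (M, c, s) \<Rightarrow>
     (\<Sum>r\<in>R. l r * M r) + c \<ge> 0 \<and> (s \<longrightarrow> (\<Sum>r\<in>R. l r * M r) + c > 0))"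

lemma separating_value:
  fixes L U :: "'a \<Rightarrow> real"
  assumes "finite P" "finite Q"
    and "\<And>p q. p \<in> P \<Longrightarrow> q \<in> Q \<Longrightarrow> L p \<le> U q \<and> (S p \<or> S q \<longrightarrow> L p < U q)"
  shows "\<exists>t. (\<forall>p\<in>P. L p \<le> t \<and> (S p \<longrightarrow> L p < t)) \<and> (\<forall>q\<in>Q. t \<le> U q \<and> (S q \<longrightarrow> t < U q))"
proof (cases "P = {}")
  case True
  show ?thesis
  proof (cases "Q = {}")
    case False
    have "Min (U ` Q) \<le> U q" if "q \<in> Q" for q using that assms(2) by simp
    then have "\<forall>q\<in>Q. Min (U ` Q) - 1 < U q" by fastforce
    then show ?thesis using True by (intro exI[of _ "Min (U ` Q) - 1"]) auto
  qed (use True in auto)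
next
  case P: False
  define a where "a = Max (L ` P)"
  have a: "\<And>p. p \<in> P \<Longrightarrow> L p \<le> a" unfolding a_def using assms(1) by simp
  obtain p0 where p0: "p0 \<in> P" "a = L p0"
    using Max_in[of "L ` P"] P assms(1) unfolding a_def by fastforce
  show ?thesis
  proof (cases "Q = {}")
    case True
    have "\<forall>p\<in>P. L p < a + 1" using a by fastforce
    then show ?thesis using True by (intro exI[of _ "a + 1"]) auto
  next
    case False
    define b where "b = Min (U ` Q)"
    have b: "\<And>q. q \<in> Q \<Longrightarrow> b \<le> U q" unfolding b_def using assms(2) by simp
    obtain q0 where q0: "q0 \<in> Q" "b = U q0"
      using Min_in[of "U ` Q"] False assms(2) unfolding b_def by fastforce
    have ab: "a \<le> b" using assms(3)[OF p0(1) q0(1)] p0 q0 by simp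
    have "L p \<le> (a + b) / 2 \<and> (S p \<longrightarrow> L p < (a + b) / 2)" if "p \<in> P" for p
      using a[OF that] ab assms(3)[OF that q0(1)] q0(2) by argo
    moreover have "(a + b) / 2 \<le> U q \<and> (S q \<longrightarrow> (a + b) / 2 < U q)" if "q \<in> Q" for q
      using b[OF that] ab assms(3)[OF p0(1) that] p0(2) by argo
    ultimately show ?thesis by blast
  qed
qed

lemma ineq_cone_trans:
  assumes "x \<in> ineq_cone X'" "X' \<subseteq> ineq_cone X"
  shows "x \<in> ineq_cone X"
  using assms by (induction rule: ineq_cone.induct) (auto intro: ineq_cone.intros)

lemma ineq_cone_coeff_zero:
  assumes "x \<in> ineq_cone X" "\<And>x. x \<in> X \<Longrightarrow> fst x r = 0"
  shows "fst x r = 0"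
  using assms by (induction rule: ineq_cone.induct) auto

text \<open>
Fourier-Motzkin elimination of one unknown at a time: the inequalities in which the unknown has a
positive coefficient are lower bounds for it, those with a negative coefficient are upper bounds,
and the positive combinations that cancel it say precisely that each lower bound is below each
upper bound.
\<close>

theorem motzkin_transposition:
  fixes X :: "(('r \<Rightarrow> real) \<times> real \<times> bool) set"
  assumes "finite R" "finite X"
  shows "(\<exists>l. \<forall>x\<in>X. ineq_holds R l x) \<or>
    (\<exists>M c s. (M, c, s) \<in> ineq_cone X \<and> (\<forall>r\<in>R. M r = 0) \<and> (c < 0 \<or> s \<and> c \<le> 0))"
  using assms
proof (induction R arbitrary: X rule: finite_induct)
  case empty
  show ?case
  proof (cases "\<forall>x\<in>X. ineq_holds {} (\<lambda>_. 0) x")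
    case False
    then obtain M c s where "(M, c, s) \<in> X" "c < 0 \<or> s \<and> c \<le> 0"
      by (fastforce simp: ineq_holds_def)
    then show ?thesis using ineq_cone.base by blast
  qed blast
next
  case (insert r R)
  define P where "P = {x \<in> X. fst x r > 0}"
  define Q where "Q = {x \<in> X. fst x r < 0}"
  define comb :: "('r \<Rightarrow> real) \<times> real \<times> bool \<Rightarrow> _ \<Rightarrow> ('r \<Rightarrow> real) \<times> real \<times> bool"
    where "comb = (\<lambda>x y.
    (\<lambda>r'. (- fst y r) * fst x r' + fst x r * fst y r',
     (- fst y r) * fst (snd x) + fst x r * fst (snd y), snd (snd x) \<or> snd (snd y)))"
  define X' where "X' = {x \<in> X. fst x r = 0} \<union> case_prod comb ` (P \<times> Q)"
  have fin: "finite X'" "finite P" "finite Q" using insert.prems by (auto simp: X'_def P_def Q_def)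
  have sub: "X' \<subseteq> ineq_cone X"
  proof
    fix z assume "z \<in> X'"
    then consider "z \<in> X" | x y where "x \<in> P" "y \<in> Q" "z = comb x y" by (auto simp: X'_def)
    then show "z \<in> ineq_cone X"
    proof cases
      case 2
      obtain M c s where x: "x = (M, c, s)" by (metis prod_cases3)
      obtain M' c' s' where y: "y = (M', c', s')" by (metis prod_cases3)
      have "(\<lambda>r'. (- M' r) * M r', (- M' r) * c, s) \<in> ineq_cone X"
        using 2 by (intro ineq_cone.scale ineq_cone.base) (auto simp: x y P_def Q_def)
      moreover have "(\<lambda>r'. M r * M' r', M r * c', s') \<in> ineq_cone X"
        using 2 by (intro ineq_cone.scale ineq_cone.base) (auto simp: x y P_def Q_def)
      ultimately show ?thesis using ineq_cone.add[of _ _ _ X] 2(3) unfolding comb_def x y by fastforce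
    qed (rule ineq_cone.base)
  qed
  have zero: "fst x r = 0" if "x \<in> X'" for x
    using that by (auto simp: X'_def comb_def)
  from insert.IH[OF fin(1)] show ?case
  proof
    assume "\<exists>M c s. (M, c, s) \<in> ineq_cone X' \<and> (\<forall>r\<in>R. M r = 0) \<and> (c < 0 \<or> s \<and> c \<le> 0)"
    then obtain M c s where *: "(M, c, s) \<in> ineq_cone X'" "\<forall>r\<in>R. M r = 0" "c < 0 \<or> s \<and> c \<le> 0"
      by blast
    have "M r = 0" using ineq_cone_coeff_zero[OF *(1) zero] by simp
    then show ?thesis using ineq_cone_trans[OF *(1) sub] * by blast
  next
    assume "\<exists>l. \<forall>x\<in>X'. ineq_holds R l x"
    then obtain l where l: "\<And>x. x \<in> X' \<Longrightarrow> ineq_holds R l x" by blast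
    define rest where "rest = (\<lambda>x :: ('r \<Rightarrow> real) \<times> real \<times> bool. (\<Sum>r\<in>R. l r * fst x r) + fst (snd x))"
    define B where "B = (\<lambda>x. - rest x / fst x r)"
    have "\<exists>t. (\<forall>p\<in>P. B p \<le> t \<and> (snd (snd p) \<longrightarrow> B p < t)) \<and>
       (\<forall>q\<in>Q. t \<le> B q \<and> (snd (snd q) \<longrightarrow> t < B q))"
    proof (rule separating_value[OF fin(2,3)])
      fix p q assume pq: "p \<in> P" "q \<in> Q"
      have pos: "fst p r > 0" "fst q r < 0" using pq by (auto simp: P_def Q_def)
      have "comb p q \<in> X'" using pq by (auto simp: X'_def)
      from l[OF this] have "- fst q r * rest p + fst p r * rest q \<ge> 0 \<and>
         (snd (snd p) \<or> snd (snd q) \<longrightarrow> - fst q r * rest p + fst p r * rest q > 0)"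
        by (simp add: ineq_holds_def comb_def rest_def algebra_simps sum.distrib sum_distrib_left
            sum_negf sum_subtractf)
      then show "B p \<le> B q \<and> (snd (snd p) \<or> snd (snd q) \<longrightarrow> B p < B q)"
        using pos by (simp add: B_def field_simps)
    qed
    then obtain t where t: "\<And>p. p \<in> P \<Longrightarrow> B p \<le> t \<and> (snd (snd p) \<longrightarrow> B p < t)"
      "\<And>q. q \<in> Q \<Longrightarrow> t \<le> B q \<and> (snd (snd q) \<longrightarrow> t < B q)" by blast
    have "ineq_holds (insert r R) (l(r := t)) x" if x: "x \<in> X" for x
    proof -
      have *: "(\<Sum>r'\<in>insert r R. (l(r := t)) r' * fst x r') + fst (snd x) = t * fst x r + rest x"
        using insert.hyps by (auto simp: rest_def intro!: sum.cong)
      have "t * fst x r + rest x \<ge> 0 \<and> (snd (snd x) \<longrightarrow> t * fst x r + rest x > 0)"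
      proof (cases "fst x r" "0::real" rule: linorder_cases)
        case less
        then show ?thesis using t(2)[of x] x by (auto simp: Q_def B_def field_simps)
      next
        case equal
        then have "x \<in> X'" using x by (simp add: X'_def)
        then show ?thesis using l[of x] equal by (auto simp: ineq_holds_def rest_def split: prod.splits)
      next
        case greater
        then show ?thesis using t(1)[of x] x by (auto simp: P_def B_def field_simps)
      qed
      then show ?thesis unfolding ineq_holds_def using * by (auto split: prod.splits)
    qed
    then show ?thesis by blast
  qed
qed

text \<open>
The form of duality used below for \<open>U\<close> the support of an optimum: the first alternative is a
strictly complementary dual solution, the second a feasible direction that either improves the
optimum or enlarges its support. An equation is entered into the transposition theorem as a pair
of opposite inequalities, which is why \<open>\<delta>\<close> is unrestricted in sign on \<open>U\<close>.
\<close>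

theorem equality_strictness_alternative:
  fixes A :: "'r \<Rightarrow> 'e \<Rightarrow> real" and c :: "'e \<Rightarrow> real"
  assumes "finite R" "finite E" "U \<subseteq> E"
  shows "(\<exists>l. (\<forall>e\<in>U. (\<Sum>r\<in>R. l r * A r e) + c e = 0) \<and>
              (\<forall>e\<in>E - U. (\<Sum>r\<in>R. l r * A r e) + c e > 0)) \<or>
    (\<exists>\<delta>. (\<forall>e\<in>E - U. \<delta> e \<ge> 0) \<and> (\<forall>r\<in>R. (\<Sum>e\<in>E. \<delta> e * A r e) = 0) \<and>
         ((\<Sum>e\<in>E. \<delta> e * c e) < 0 \<or> (\<Sum>e\<in>E. \<delta> e * c e) \<le> 0 \<and> (\<exists>e\<in>E - U. \<delta> e > 0)))"
proof -
  define row where "row = (\<lambda>e s. (\<lambda>r. A r e, c e, s :: bool))"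
  define neg where "neg = (\<lambda>e. (\<lambda>r. - A r e, - c e, False))"
  define X where "X = (\<lambda>e. row e True) ` (E - U) \<union> (\<lambda>e. row e False) ` U \<union> neg ` U"
  have fin: "finite X" using assms finite_subset[OF assms(3)] by (simp add: X_def)
  define Q where "Q = (\<lambda>(M, d, s). \<exists>\<delta>. (\<forall>e\<in>E - U. \<delta> e \<ge> 0) \<and> (\<forall>r. M r = (\<Sum>e\<in>E. \<delta> e * A r e)) \<and>
     d = (\<Sum>e\<in>E. \<delta> e * c e) \<and> (s \<longrightarrow> (\<exists>e\<in>E - U. \<delta> e > 0)))"
  have delta: "(\<Sum>e'\<in>E. (if e' = e then a else 0) * g e') = a * g e" if "e \<in> E" for e a and g :: "'e \<Rightarrow> real"
    using that assms(2) by (simp add: if_distrib[of "\<lambda>x. x * _"] cong: if_cong)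
  have Q: "Q x" if "x \<in> ineq_cone X" for x
    using that
  proof (induction rule: ineq_cone.induct)
    case (base x)
    then consider e where "e \<in> E - U" "x = row e True" | e where "e \<in> U" "x = row e False"
      | e where "e \<in> U" "x = neg e" by (auto simp: X_def)
    then show ?case
    proof cases
      case (1 e)
      then show ?thesis unfolding Q_def row_def using delta[of e 1]
        by (auto intro!: exI[of _ "\<lambda>e'. if e' = e then 1 else 0"])
    next
      case (2 e)
      then show ?thesis unfolding Q_def row_def using delta[of e 1] assms(3)
        by (auto intro!: exI[of _ "\<lambda>e'. if e' = e then 1 else 0"] simp: subset_iff)
    next
      case (3 e)
      then show ?thesis unfolding Q_def neg_def using delta[of e "-1"] assms(3)
        by (auto intro!: exI[of _ "\<lambda>e'. if e' = e then -1 else 0"] simp: subset_iff)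
    qed
  next
    case (add M d s M' d' s')
    then obtain \<delta> \<delta>' where 1:
      "\<And>e. e \<in> E - U \<Longrightarrow> \<delta> e \<ge> 0" "\<And>r. M r = (\<Sum>e\<in>E. \<delta> e * A r e)" "d = (\<Sum>e\<in>E. \<delta> e * c e)"
      "s \<Longrightarrow> \<exists>e\<in>E - U. \<delta> e > 0"
      and 2: "\<And>e. e \<in> E - U \<Longrightarrow> \<delta>' e \<ge> 0" "\<And>r. M' r = (\<Sum>e\<in>E. \<delta>' e * A r e)" "d' = (\<Sum>e\<in>E. \<delta>' e * c e)"
      "s' \<Longrightarrow> \<exists>e\<in>E - U. \<delta>' e > 0"
      unfolding Q_def by blast
    have "\<exists>e\<in>E - U. \<delta> e + \<delta>' e > 0" if ss: "s \<or> s'"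
    proof (cases s)
      case True
      then obtain e where "e \<in> E - U" "\<delta> e > 0" using 1(4) by blast
      then show ?thesis using 2(1)[of e] by (intro bexI[of _ e]) auto
    next
      case False
      then obtain e where "e \<in> E - U" "\<delta>' e > 0" using 2(4) ss by blast
      then show ?thesis using 1(1)[of e] by (intro bexI[of _ e]) auto
    qed
    then show ?case unfolding Q_def prod.case
      by (intro exI[of _ "\<lambda>e. \<delta> e + \<delta>' e"]) (simp add: 1(1-3) 2(1-3) sum.distrib distrib_right)
  next
    case (scale M d s t)
    then obtain \<delta> where 1:
      "\<And>e. e \<in> E - U \<Longrightarrow> \<delta> e \<ge> 0" "\<And>r. M r = (\<Sum>e\<in>E. \<delta> e * A r e)" "d = (\<Sum>e\<in>E. \<delta> e * c e)"
      "s \<Longrightarrow> \<exists>e\<in>E - U. \<delta> e > 0"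
      unfolding Q_def by blast
    have "\<exists>e\<in>E - U. t * \<delta> e > 0" if s: s
    proof -
      obtain e where "e \<in> E - U" "\<delta> e > 0" using 1(4)[OF s] by blast
      then show ?thesis using scale(2) by (intro bexI[of _ e]) auto
    qed
    then show ?case unfolding Q_def prod.case
      by (intro exI[of _ "\<lambda>e. t * \<delta> e"])
        (simp add: 1(1-3) scale(2) less_imp_le sum_distrib_left mult.assoc)
  qed
  from motzkin_transposition[OF assms(1) fin] show ?thesis
  proof
    assume "\<exists>l. \<forall>x\<in>X. ineq_holds R l x"
    then obtain l where l: "\<And>x. x \<in> X \<Longrightarrow> ineq_holds R l x" by blast
    have "(\<Sum>r\<in>R. l r * A r e) + c e = 0" if "e \<in> U" for e
    proof -
      have "row e False \<in> X" "neg e \<in> X" using that by (auto simp: X_def)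
      then show ?thesis using l[of "row e False"] l[of "neg e"]
        by (simp add: row_def neg_def ineq_holds_def sum_negf)
    qed
    moreover have "(\<Sum>r\<in>R. l r * A r e) + c e > 0" if "e \<in> E - U" for e
    proof -
      have "row e True \<in> X" using that by (auto simp: X_def)
      then show ?thesis using l[of "row e True"] by (simp add: row_def ineq_holds_def)
    qed
    ultimately show ?thesis by blast
  next
    assume "\<exists>M d s. (M, d, s) \<in> ineq_cone X \<and> (\<forall>r\<in>R. M r = 0) \<and> (d < 0 \<or> s \<and> d \<le> 0)"
    then obtain M d s where *: "(M, d, s) \<in> ineq_cone X" "\<forall>r\<in>R. M r = 0" "d < 0 \<or> s \<and> d \<le> 0"
      by blast
    obtain \<delta> where \<delta>: "\<forall>e\<in>E - U. \<delta> e \<ge> 0" "\<forall>r. M r = (\<Sum>e\<in>E. \<delta> e * A r e)"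
      "d = (\<Sum>e\<in>E. \<delta> e * c e)" "s \<longrightarrow> (\<exists>e\<in>E - U. \<delta> e > 0)"
      using Q[OF *(1)] unfolding Q_def prod.case by blast
    then show ?thesis using *(2,3) by (intro disjI2 exI[of _ \<delta>]) force
  qed
qed

section \<open>Concentrating weights on few points\<close>

lemma homogeneous_nontrivial_solution:
  fixes M :: "'r \<Rightarrow> 'x \<Rightarrow> real"
  assumes "finite R" "finite X" "card R < card X"
  shows "\<exists>\<delta>. (\<exists>x\<in>X. \<delta> x \<noteq> 0) \<and> (\<forall>r\<in>R. (\<Sum>x\<in>X. \<delta> x * M r x) = 0)"
  using assms
proof (induction R arbitrary: X M rule: finite_induct)
  case empty
  then have "X \<noteq> {}" by auto
  then show ?case by (auto intro!: exI[of _ "\<lambda>_. 1"])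
next
  case (insert r R)
  show ?case
  proof (cases "\<forall>x\<in>X. M r x = 0")
    case True
    have "card R < card X" using insert by simp
    then obtain \<delta> where "\<exists>x\<in>X. \<delta> x \<noteq> 0" "\<forall>r\<in>R. (\<Sum>x\<in>X. \<delta> x * M r x) = 0"
      using insert.IH[OF insert.prems(1)] by blast
    then show ?thesis using True by (intro exI[of _ \<delta>]) simp
  next
    case False
    then obtain x0 where x0: "x0 \<in> X" "M r x0 \<noteq> 0" by blast
    define X' where "X' = X - {x0}"
    define M' where "M' = (\<lambda>r' x. M r' x - M r' x0 * M r x / M r x0)"
    have "card R < card X'" using insert x0 by (simp add: X'_def)
    then obtain \<delta> where \<delta>: "\<exists>x\<in>X'. \<delta> x \<noteq> 0" "\<forall>r\<in>R. (\<Sum>x\<in>X'. \<delta> x * M' r x) = 0"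
      using insert.IH[of X' M'] insert.prems by (auto simp: X'_def)
    define t where "t = - (\<Sum>x\<in>X'. \<delta> x * M r x) / M r x0"
    define \<delta>' where "\<delta>' = \<delta>(x0 := t)"
    have sum: "(\<Sum>x\<in>X. \<delta>' x * g x) = t * g x0 + (\<Sum>x\<in>X'. \<delta> x * g x)" for g
    proof -
      have "(\<Sum>x\<in>X. \<delta>' x * g x) = \<delta>' x0 * g x0 + (\<Sum>x\<in>X'. \<delta>' x * g x)"
        unfolding X'_def by (rule sum.remove[OF insert.prems(1) x0(1)])
      also have "(\<Sum>x\<in>X'. \<delta>' x * g x) = (\<Sum>x\<in>X'. \<delta> x * g x)"
        by (rule sum.cong) (auto simp: \<delta>'_def X'_def)
      finally show ?thesis by (simp add: \<delta>'_def)
    qed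
    have "(\<Sum>x\<in>X. \<delta>' x * M r' x) = 0" if "r' \<in> insert r R" for r'
    proof (cases "r' = r")
      case True
      then show ?thesis using x0 by (simp add: sum t_def)
    next
      case False
      then have "(\<Sum>x\<in>X'. \<delta> x * M' r' x) = 0" using that \<delta> by auto
      moreover have "(\<Sum>x\<in>X'. \<delta> x * M' r' x) = (\<Sum>x\<in>X'. \<delta> x * M r' x) - M r' x0 / M r x0 * (\<Sum>x\<in>X'. \<delta> x * M r x)"
        by (simp add: M'_def sum_subtractf sum_distrib_left algebra_simps)
      ultimately show ?thesis by (simp add: sum t_def algebra_simps)
    qed
    moreover have "\<exists>x\<in>X. \<delta>' x \<noteq> 0" using \<delta>(1) by (auto simp: \<delta>'_def X'_def)
    ultimately show ?thesis by blast
  qed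
qed

text \<open>
Caratheodory's argument: as long as more than \<open>n + 1\<close> points carry the weights, an affine dependence
between them allows one weight to be moved to zero without changing the total and the first
moments. Finally a total exceeding \<open>n + 1\<close> is distributed over at most \<open>n + 1\<close> points.
\<close>

lemma concentrate_weights:
  fixes V :: "nat \<Rightarrow> 'e \<Rightarrow> real"
  assumes "finite G" "\<And>e. e \<in> G \<Longrightarrow> w e \<ge> 0" "sum w G > real n + 1"
  shows "\<exists>w'. (\<forall>e\<in>G. w' e \<ge> 0) \<and> (\<forall>i<n. (\<Sum>e\<in>G. w' e * V i e) = (\<Sum>e\<in>G. w e * V i e)) \<and>
    sum w' G = sum w G \<and> (\<exists>v\<in>G. w' v > 1)"
  using assms
proof (induction "card G" arbitrary: G w rule: less_induct)
  case less
  show ?case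
  proof (cases "card G \<le> n + 1")
    case True
    have "\<exists>v\<in>G. w v > 1"
    proof (rule ccontr)
      assume "\<not> ?thesis"
      then have "sum w G \<le> real (card G) * 1" by (intro sum_bounded_above) auto
      also have "\<dots> \<le> real n + 1" using True by linarith
      finally show False using less.prems by simp
    qed
    then show ?thesis using less.prems by (intro exI[of _ w]) auto
  next
    case False
    define R where "R = insert None (Some ` {..<n})"
    have "card R = n + 1" by (simp add: R_def card_image)
    moreover have "finite R" by (simp add: R_def)
    ultimately have "\<exists>\<delta>0. (\<exists>x\<in>G. \<delta>0 x \<noteq> 0) \<and>
        (\<forall>r\<in>R. (\<Sum>x\<in>G. \<delta>0 x * (case r of None \<Rightarrow> 1 | Some i \<Rightarrow> V i x)) = 0)"
      using False less.prems(1) by (intro homogeneous_nontrivial_solution) auto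
    then obtain \<delta>0 where \<delta>0: "\<exists>x\<in>G. \<delta>0 x \<noteq> 0"
      "\<And>r. r \<in> R \<Longrightarrow> (\<Sum>x\<in>G. \<delta>0 x * (case r of None \<Rightarrow> 1 | Some i \<Rightarrow> V i x)) = 0"
      by blast
    have z: "sum \<delta>0 G = 0" "\<And>i. i < n \<Longrightarrow> (\<Sum>x\<in>G. \<delta>0 x * V i x) = 0"
      using \<delta>0(2)[of None] \<delta>0(2)[of "Some _"] by (auto simp: R_def)
    have "\<exists>x\<in>G. \<delta>0 x > 0"
    proof (rule ccontr)
      assume "\<not> ?thesis"
      then have "\<forall>x\<in>G. - \<delta>0 x \<ge> 0" by force
      moreover have "(\<Sum>x\<in>G. - \<delta>0 x) = 0" using z by (simp add: sum_negf)
      ultimately have "\<forall>x\<in>G. - \<delta>0 x = 0" using sum_nonneg_eq_0_iff[OF less.prems(1), of "\<lambda>x. - \<delta>0 x"] by simp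
      then show False using \<delta>0(1) by auto
    qed
    then have ne: "{x \<in> G. \<delta>0 x > 0} \<noteq> {}" by auto
    define T where "T = (\<lambda>x. w x / \<delta>0 x) ` {x \<in> G. \<delta>0 x > 0}"
    have T: "finite T" "T \<noteq> {}" using ne less.prems(1) by (auto simp: T_def)
    define t where "t = Min T"
    obtain e0 where e0: "e0 \<in> G" "\<delta>0 e0 > 0" "t = w e0 / \<delta>0 e0"
      using Min_in[OF T] by (auto simp: T_def t_def)
    have t: "t \<le> w x / \<delta>0 x" if "x \<in> G" "\<delta>0 x > 0" for x
      unfolding t_def by (rule Min_le[OF T(1)]) (use that in \<open>auto simp: T_def\<close>)
    have t0: "t \<ge> 0" using e0 less.prems(2)[of e0] by simp
    define w1 where "w1 = (\<lambda>x. w x - t * \<delta>0 x)"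
    have w1: "w1 x \<ge> 0" if "x \<in> G" for x
    proof (cases "\<delta>0 x > 0")
      case True
      then show ?thesis using t[OF that True] by (simp add: w1_def field_simps)
    next
      case False
      then have "t * \<delta>0 x \<le> 0" using t0 by (simp add: mult_nonneg_nonpos)
      then show ?thesis using less.prems(2)[OF that] by (simp add: w1_def)
    qed
    have w1e0: "w1 e0 = 0" using e0 by (simp add: w1_def)
    define G' where "G' = G - {e0}"
    have rem: "sum g G = g e0 + sum g G'" for g :: "'e \<Rightarrow> real"
      unfolding G'_def by (rule sum.remove[OF less.prems(1) e0(1)])
    have s1: "sum w1 G = sum w G" using z by (simp add: w1_def sum_subtractf sum_distrib_left[symmetric])
    have s2: "(\<Sum>e\<in>G. w1 e * V i e) = (\<Sum>e\<in>G. w e * V i e)" if "i < n" for i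
      using z(2)[OF that] by (simp add: w1_def sum_subtractf left_diff_distrib mult.assoc sum_distrib_left[symmetric])
    have "\<exists>w'. (\<forall>e\<in>G'. w' e \<ge> 0) \<and> (\<forall>i<n. (\<Sum>e\<in>G'. w' e * V i e) = (\<Sum>e\<in>G'. w1 e * V i e)) \<and>
      sum w' G' = sum w1 G' \<and> (\<exists>v\<in>G'. w' v > 1)"
    proof (rule less.hyps)
      show "card G' < card G" using e0 less.prems(1) unfolding G'_def by (intro card_Diff1_less)
      show "sum w1 G' > real n + 1" using rem[of w1] w1e0 s1 less.prems(3) by simp
    qed (use less.prems w1 in \<open>auto simp: G'_def\<close>)
    then obtain w' where w': "\<forall>e\<in>G'. w' e \<ge> 0"
      "\<forall>i<n. (\<Sum>e\<in>G'. w' e * V i e) = (\<Sum>e\<in>G'. w1 e * V i e)" "sum w' G' = sum w1 G'" "\<exists>v\<in>G'. w' v > 1"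
      by blast
    define w2 where "w2 = w'(e0 := 0)"
    have c: "(\<Sum>e\<in>G. w2 e * g e) = (\<Sum>e\<in>G'. w' e * g e)" for g
      using rem[of "\<lambda>e. w2 e * g e"] by (auto simp: w2_def G'_def intro!: sum.cong)
    have "\<forall>e\<in>G. w2 e \<ge> 0" using w'(1) by (auto simp: w2_def G'_def)
    moreover have "(\<Sum>e\<in>G. w2 e * V i e) = (\<Sum>e\<in>G. w e * V i e)" if "i < n" for i
      using c[of "V i"] w'(2) that s2[OF that] rem[of "\<lambda>e. w1 e * V i e"] w1e0 by simp
    moreover have "sum w2 G = sum w G" using c[of "\<lambda>_. 1"] w'(3) s1 rem[of w1] w1e0 by simp
    moreover have "\<exists>v\<in>G. w2 v > 1" using w'(4) by (auto simp: w2_def G'_def)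
    ultimately show ?thesis by blast
  qed
qed

section \<open>Optimal representations by weighted generators\<close>

text \<open>
The groups are numbered by \<open>j < k\<close>; a generator with \<open>grp e \<ge> k\<close> is free, that is, its weight is
not part of any prescribed total. The last assumption keeps the set of representations of a given
vector bounded: the weight of \<open>e\<close> is limited by the total of its group or by a coordinate of the
vector.
\<close>

locale weighted_generators =
  fixes E :: "'e set" and n k :: nat and T :: real
    and u :: "'e \<Rightarrow> nat \<Rightarrow> nat" and cost :: "'e \<Rightarrow> real" and grp :: "'e \<Rightarrow> nat"
  assumes finite_E: "finite E"
    and total_large: "T > real n + 1"
    and anchored: "\<And>e. e \<in> E \<Longrightarrow> grp e < k \<or> (\<exists>i<n. u e i > 0)"
begin

text \<open>
The constraints on the weights form one linear system, with a row \<open>Inl i\<close> for each coordinate and a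
row \<open>Inr j\<close> for each group.
\<close>

definition rows :: "(nat + nat) set" where
  "rows = {..<n} <+> {..<k}"

definition entry :: "nat + nat \<Rightarrow> 'e \<Rightarrow> real" where
  "entry r e = (case r of Inl i \<Rightarrow> real (u e i) | Inr j \<Rightarrow> of_bool (grp e = j))"

definition rhs :: "(nat \<Rightarrow> nat) \<Rightarrow> nat + nat \<Rightarrow> real" where
  "rhs K r = (case r of Inl i \<Rightarrow> real (K i) | Inr j \<Rightarrow> T)"

definition represents :: "('e \<Rightarrow> real) \<Rightarrow> (nat \<Rightarrow> nat) \<Rightarrow> bool" where
  "represents w K \<longleftrightarrow> (\<forall>e\<in>E. w e \<ge> 0) \<and> (\<forall>e. e \<notin> E \<longrightarrow> w e = 0) \<and>
     (\<forall>r\<in>rows. (\<Sum>e\<in>E. w e * entry r e) = rhs K r)"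

definition objective :: "((nat \<Rightarrow> nat) \<Rightarrow> real) \<Rightarrow> (nat \<Rightarrow> nat) \<Rightarrow> ('e \<Rightarrow> real) \<Rightarrow> real" where
  "objective y K w = y K + (\<Sum>e\<in>E. w e * cost e)"

text \<open>
The reduced cost of linear programming. Free generators have no offset; this is expressed by
letting \<open>b\<close> vanish from \<open>k\<close> on.
\<close>

definition slack :: "(nat \<Rightarrow> real) \<Rightarrow> (nat \<Rightarrow> real) \<Rightarrow> 'e \<Rightarrow> real" where
  "slack a b e = cost e + (\<Sum>i<n. a i * real (u e i)) - b (grp e)"

lemma finite_rows: "finite rows"
  by (simp add: rows_def)

lemma entry_nonneg: "entry r e \<ge> 0"
  by (auto simp: entry_def split: sum.split)

lemma represents_row:
  assumes "represents w K"
  shows "i < n \<Longrightarrow> (\<Sum>e\<in>E. w e * real (u e i)) = real (K i)"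
    and "j < k \<Longrightarrow> (\<Sum>e\<in>E. w e * of_bool (grp e = j)) = T"
  using assms unfolding represents_def rows_def
  by (force dest: bspec[of _ _ "Inl i"] bspec[of _ _ "Inr j"] simp: entry_def rhs_def)+

lemma weight_le:
  assumes "represents w K" "e \<in> E" "r \<in> rows" "entry r e \<ge> 1"
  shows "w e \<le> rhs K r"
proof -
  have w: "w x \<ge> 0" if "x \<in> E" for x using assms(1) that by (simp add: represents_def)
  have "w e \<le> w e * entry r e" using mult_left_mono[OF assms(4) w[OF assms(2)]] by simp
  also have "\<dots> \<le> (\<Sum>e\<in>E. w e * entry r e)"
    by (rule member_le_sum) (use assms w entry_nonneg finite_E in auto)
  finally show ?thesis using assms(1,3) by (simp add: represents_def)
qed

lemma weight_bound:
  assumes "represents w K" "e \<in> E"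
  shows "w e \<le> T + (\<Sum>i<n. real (K i))"
  using anchored[OF assms(2)]
proof (elim disjE exE conjE)
  assume "grp e < k"
  then have "w e \<le> rhs K (Inr (grp e))"
    by (intro weight_le assms) (auto simp: rows_def entry_def)
  moreover have "(\<Sum>i<n. real (K i)) \<ge> 0" by (intro sum_nonneg) auto
  ultimately show ?thesis by (simp add: rhs_def)
next
  fix i assume i: "i < n" "u e i > 0"
  then have "w e \<le> rhs K (Inl i)"
    by (intro weight_le assms) (auto simp: rows_def entry_def)
  moreover have "real (K i) \<le> (\<Sum>i<n. real (K i))" by (rule member_le_sum) (use i in auto)
  ultimately show ?thesis using total_large by (simp add: rhs_def)
qed

lemma compact_representations: "compact {w. represents w K}"
proof -
  define B where "B = T + (\<Sum>i<n. real (K i))"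
  define S where "S = (\<lambda>e. if e \<in> E then {0..B} else {0})"
  have "compactin (product_topology (\<lambda>_. euclidean) UNIV) (PiE UNIV S)"
    unfolding compactin_PiE by (auto simp: S_def)
  then have box: "compact (PiE UNIV S)" by (simp add: euclidean_product_topology)
  have "closed (\<Inter>r\<in>rows. {w. (\<Sum>e\<in>E. w e * entry r e) = rhs K r})"
    by (intro closed_INT ballI closed_Collect_eq continuous_intros
        continuous_on_product_coordinates)
  then have "compact (PiE UNIV S \<inter> (\<Inter>r\<in>rows. {w. (\<Sum>e\<in>E. w e * entry r e) = rhs K r}))"
    using box by (rule compact_Int_closed[rotated])
  moreover have "{w. represents w K} =
      PiE UNIV S \<inter> (\<Inter>r\<in>rows. {w. (\<Sum>e\<in>E. w e * entry r e) = rhs K r})"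
    using weight_bound[of _ K] by (fastforce simp: represents_def S_def B_def PiE_iff split: if_splits)
  ultimately show ?thesis by simp
qed

text \<open>
For each of the finitely many \<open>K\<close> the representations form a compact polytope, on which the
objective is continuous.
\<close>

lemma optimum_attained:
  assumes "finite KS" "K0 \<in> KS" "represents w0 K0"
  shows "\<exists>K\<in>KS. \<exists>w. represents w K \<and>
    (\<forall>K'\<in>KS. \<forall>w'. represents w' K' \<longrightarrow> objective y K w \<le> objective y K' w')"
proof -
  define KR where "KR = {K \<in> KS. \<exists>w. represents w K}"
  have "\<exists>w. represents w K \<and> (\<forall>w'. represents w' K \<longrightarrow> objective y K w \<le> objective y K w')"
    if "K \<in> KR" for K
  proof -
    have "continuous_on {w. represents w K} (objective y K)"
      unfolding objective_def
      by (intro continuous_intros continuous_on_subset[OF continuous_on_product_coordinates]) auto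
    then show ?thesis
      using continuous_attains_inf[OF compact_representations[of K], of "objective y K"] that
      by (auto simp: KR_def)
  qed
  then obtain W where W: "\<And>K. K \<in> KR \<Longrightarrow> represents (W K) K"
    "\<And>K w'. K \<in> KR \<Longrightarrow> represents w' K \<Longrightarrow> objective y K (W K) \<le> objective y K w'"
    by metis
  have fin: "finite ((\<lambda>K. objective y K (W K)) ` KR)" "(\<lambda>K. objective y K (W K)) ` KR \<noteq> {}"
    using assms by (auto simp: KR_def)
  obtain K where K: "K \<in> KR" "objective y K (W K) = Min ((\<lambda>K. objective y K (W K)) ` KR)"
    using Min_in[OF fin] by auto
  have "objective y K (W K) \<le> objective y K' w'" if "K' \<in> KS" "represents w' K'" for K' w'
  proof -
    have "K' \<in> KR" using that by (auto simp: KR_def)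
    then have "objective y K (W K) \<le> objective y K' (W K')"
      unfolding K(2) by (intro Min_le fin) auto
    also have "\<dots> \<le> objective y K' w'" using W(2)[OF \<open>K' \<in> KR\<close> that(2)] .
    finally show ?thesis .
  qed
  moreover have "K \<in> KS" using K(1) by (simp add: KR_def)
  ultimately show ?thesis using W(1)[OF K(1)] by blast
qed

lemma small_perturbation_positive:
  fixes w \<delta> :: "'x \<Rightarrow> real"
  assumes "finite U" "\<And>e. e \<in> U \<Longrightarrow> w e > 0"
  shows "\<exists>\<epsilon>>0. \<forall>e\<in>U. w e + \<epsilon> * \<delta> e > 0"
proof -
  define V where "V = insert 1 ((\<lambda>e. w e / (1 + \<bar>\<delta> e\<bar>)) ` U)"
  have V: "finite V" "V \<noteq> {}" using assms by (auto simp: V_def)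
  have pos: "Min V > 0" using assms by (subst Min_gr_iff[OF V]) (auto simp: V_def)
  have "w e + Min V * \<delta> e > 0" if e: "e \<in> U" for e
  proof -
    have "Min V \<le> w e / (1 + \<bar>\<delta> e\<bar>)" by (rule Min_le[OF V(1)]) (use e in \<open>auto simp: V_def\<close>)
    then have "Min V * (1 + \<bar>\<delta> e\<bar>) \<le> w e" by (simp add: field_simps)
    moreover have "- (Min V * \<delta> e) \<le> Min V * \<bar>\<delta> e\<bar>"
      using pos by (metis abs_ge_minus_self less_imp_le mult_left_mono mult_minus_right)
    ultimately show ?thesis using pos by (simp add: algebra_simps)
  qed
  then show ?thesis using pos by blast
qed

lemma objective_add: "objective y K (\<lambda>e. w e + t * \<delta> e) = objective y K w + t * (\<Sum>e\<in>E. \<delta> e * cost e)"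
  by (simp add: objective_def algebra_simps sum.distrib sum_distrib_left)

lemma rows_sum:
  "(\<Sum>r\<in>rows. l r * entry r e) =
    (\<Sum>i<n. l (Inl i) * real (u e i)) + (if grp e < k then l (Inr (grp e)) else 0)"
  unfolding rows_def by (subst sum.Plus) (auto simp: entry_def of_bool_def if_distrib cong: if_cong)

text \<open>
An optimum with the largest possible support \<open>U\<close> admits no direction of the second kind in
\<open>equality_strictness_alternative\<close>: following such a direction by a small amount keeps the weights on
\<open>U\<close> positive and would contradict either optimality or the choice of \<open>U\<close>. The multipliers of the
first kind become \<open>a\<close> on the coordinate rows and \<open>- b\<close> on the group rows.
\<close>

theorem strictly_complementary_optimum:
  assumes "finite KS" "K0 \<in> KS" "represents w0 K0"
  obtains K w U a b where "K \<in> KS" "represents w K" "U = {e \<in> E. w e > 0}"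
    "\<And>K' w'. K' \<in> KS \<Longrightarrow> represents w' K' \<Longrightarrow> objective y K w \<le> objective y K' w'"
    "\<And>K' w'. K' \<in> KS \<Longrightarrow> represents w' K' \<Longrightarrow> objective y K' w' \<le> objective y K w \<Longrightarrow>
       card {e \<in> E. w' e > 0} \<le> card U"
    "\<And>e. e \<in> U \<Longrightarrow> slack a b e = 0" "\<And>e. e \<in> E - U \<Longrightarrow> slack a b e > 0"
    "\<And>j. j \<ge> k \<Longrightarrow> b j = 0"
proof -
  define opt where "opt = (\<lambda>(K, w). K \<in> KS \<and> represents w K \<and>
    (\<forall>K'\<in>KS. \<forall>w'. represents w' K' \<longrightarrow> objective y K w \<le> objective y K' w'))"
  obtain K1 w1 where "K1 \<in> KS" "represents w1 K1"
    "\<forall>K'\<in>KS. \<forall>w'. represents w' K' \<longrightarrow> objective y K1 w1 \<le> objective y K' w'"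
    using optimum_attained[OF assms, of y] by blast
  then have "opt (K1, w1)" by (simp add: opt_def)
  moreover have "card {e \<in> E. snd p e > 0} < Suc (card E)" for p :: "(nat \<Rightarrow> nat) \<times> ('e \<Rightarrow> real)"
  proof -
    have "card {e \<in> E. snd p e > 0} \<le> card E" by (rule card_mono[OF finite_E]) auto
    then show ?thesis by simp
  qed
  ultimately obtain p where p: "opt p"
    "\<And>q. opt q \<Longrightarrow> card {e \<in> E. snd q e > 0} \<le> card {e \<in> E. snd p e > 0}"
    using ex_has_greatest_nat[of opt "(K1, w1)" "\<lambda>p. card {e \<in> E. snd p e > 0}" "Suc (card E)"] by metis
  obtain K w where Kw: "p = (K, w)" by (cases p)
  define U where "U = {e \<in> E. w e > 0}"
  have K: "K \<in> KS" and w: "represents w K"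
    and opt: "\<And>K' w'. K' \<in> KS \<Longrightarrow> represents w' K' \<Longrightarrow> objective y K w \<le> objective y K' w'"
    using p(1) by (auto simp: opt_def Kw)
  have maxi: "card {e \<in> E. w' e > 0} \<le> card U"
    if "K' \<in> KS" "represents w' K'" "objective y K' w' \<le> objective y K w" for K' w'
  proof -
    have "opt (K', w')" using that opt by (fastforce simp: opt_def)
    then show ?thesis using p(2)[of "(K', w')"] by (simp add: Kw U_def)
  qed
  have finU: "finite U" "U \<subseteq> E" using finite_E by (auto simp: U_def)
  have no: False
    if \<delta>: "\<forall>e\<in>E - U. \<delta> e \<ge> 0" "\<forall>r\<in>rows. (\<Sum>e\<in>E. \<delta> e * entry r e) = 0"
      "(\<Sum>e\<in>E. \<delta> e * cost e) < 0 \<or> (\<Sum>e\<in>E. \<delta> e * cost e) \<le> 0 \<and> (\<exists>e\<in>E - U. \<delta> e > 0)" for \<delta>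
  proof -
    define \<delta>' where "\<delta>' = (\<lambda>e. if e \<in> E then \<delta> e else 0)"
    have eq: "(\<Sum>e\<in>E. \<delta>' e * g e) = (\<Sum>e\<in>E. \<delta> e * g e)" for g
      by (rule sum.cong) (auto simp: \<delta>'_def)
    have "\<exists>\<epsilon>>0. \<forall>e\<in>U. w e + \<epsilon> * \<delta>' e > 0"
      by (rule small_perturbation_positive[OF finU(1)]) (simp add: U_def)
    then obtain \<epsilon> where \<epsilon>: "\<epsilon> > 0" "\<forall>e\<in>U. w e + \<epsilon> * \<delta>' e > 0" by blast
    define w' where "w' = (\<lambda>e. w e + \<epsilon> * \<delta>' e)"
    have off: "w e = 0" if "e \<in> E - U" for e
      using that w by (auto simp: U_def represents_def not_less intro: antisym)
    have "(\<Sum>e\<in>E. w' e * entry r e) = rhs K r" if "r \<in> rows" for r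
    proof -
      have "(\<Sum>e\<in>E. w' e * entry r e) = (\<Sum>e\<in>E. w e * entry r e) + \<epsilon> * (\<Sum>e\<in>E. \<delta>' e * entry r e)"
        by (simp add: w'_def algebra_simps sum.distrib sum_distrib_left)
      also have "(\<Sum>e\<in>E. \<delta>' e * entry r e) = 0" using eq \<delta>(2) that by simp
      finally show ?thesis using w that by (simp add: represents_def)
    qed
    moreover have "w' e \<ge> 0" if "e \<in> E" for e
    proof (cases "e \<in> U")
      case True
      then show ?thesis using \<epsilon>(2) less_imp_le by (auto simp: w'_def)
    next
      case False
      then have "\<delta>' e \<ge> 0" "w e = 0" using \<delta>(1) off that by (auto simp: \<delta>'_def)
      then show ?thesis using \<epsilon>(1) by (simp add: w'_def)
    qed
    moreover have "w' e = 0" if "e \<notin> E" for e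
      using w that by (simp add: w'_def \<delta>'_def represents_def)
    ultimately have w': "represents w' K" by (simp add: represents_def)
    have obj: "objective y K w' = objective y K w + \<epsilon> * (\<Sum>e\<in>E. \<delta> e * cost e)"
      by (simp add: w'_def objective_add eq)
    have "\<epsilon> * (\<Sum>e\<in>E. \<delta> e * cost e) \<ge> 0" using opt[OF K w'] obj by simp
    then have ge: "(\<Sum>e\<in>E. \<delta> e * cost e) \<ge> 0" using \<epsilon>(1) by (simp add: zero_le_mult_iff)
    then obtain e where e: "e \<in> E - U" "\<delta> e > 0" and z: "(\<Sum>e\<in>E. \<delta> e * cost e) = 0"
      using \<delta>(3) by (metis antisym not_less)
    have "card {e \<in> E. w' e > 0} \<le> card U" using maxi[OF K w'] obj z by simp
    moreover have "insert e U \<subseteq> {e \<in> E. w' e > 0}"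
      using e \<epsilon> finU(2) off[of e] by (auto simp: w'_def \<delta>'_def)
    then have "card (insert e U) \<le> card {e \<in> E. w' e > 0}"
      by (intro card_mono) (use finite_E in auto)
    ultimately show False using e finU by simp
  qed
  obtain l where l: "\<forall>e\<in>U. (\<Sum>r\<in>rows. l r * entry r e) + cost e = 0"
    "\<forall>e\<in>E - U. (\<Sum>r\<in>rows. l r * entry r e) + cost e > 0"
    using equality_strictness_alternative[OF finite_rows finite_E finU(2), of entry cost] no by blast
  define a where "a = (\<lambda>i. l (Inl i))"
  define b where "b = (\<lambda>j. if j < k then - l (Inr j) else 0)"
  have "slack a b e = (\<Sum>r\<in>rows. l r * entry r e) + cost e" for e
    by (simp add: slack_def a_def b_def rows_sum)
  then show ?thesis using that[where a = a and b = b, OF K w U_def opt maxi] l by (simp add: b_def)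
qed

text \<open>
Weights supported on generators of slack zero all have the same objective value for the same \<open>K\<close>.
This is what permits the weights of an optimum to be redistributed freely within its support.
\<close>

lemma slack_zero_objective:
  assumes "represents w K" "\<And>e. e \<in> E \<Longrightarrow> w e > 0 \<Longrightarrow> slack a b e = 0" "\<And>j. j \<ge> k \<Longrightarrow> b j = 0"
  shows "objective y K w = y K + T * (\<Sum>j<k. b j) - (\<Sum>i<n. a i * real (K i))"
proof -
  have "w e * cost e = w e * (\<Sum>j<k. b j * of_bool (grp e = j)) - w e * (\<Sum>i<n. a i * real (u e i))"
    if "e \<in> E" for e
  proof (cases "w e > 0")
    case True
    have "(\<Sum>j<k. b j * of_bool (grp e = j)) = b (grp e)"
      using assms(3)[of "grp e"] by (auto simp: of_bool_def if_distrib cong: if_cong)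
    moreover have "cost e = b (grp e) - (\<Sum>i<n. a i * real (u e i))"
      using assms(2)[OF that True] by (simp add: slack_def)
    ultimately show ?thesis by (simp only: right_diff_distrib)
  next
    case False
    then have "w e = 0" using assms(1) that by (force simp: represents_def)
    then show ?thesis by simp
  qed
  then have "(\<Sum>e\<in>E. w e * cost e) =
      (\<Sum>e\<in>E. w e * (\<Sum>j<k. b j * of_bool (grp e = j)) - w e * (\<Sum>i<n. a i * real (u e i)))"
    by (rule sum.cong[OF refl])
  also have "\<dots> =
      (\<Sum>e\<in>E. \<Sum>j<k. b j * (w e * of_bool (grp e = j))) - (\<Sum>e\<in>E. \<Sum>i<n. a i * (w e * real (u e i)))"
    by (simp only: sum_subtractf sum_distrib_left mult.left_commute[of "w _"])
  also have "\<dots> = (\<Sum>j<k. b j * (\<Sum>e\<in>E. w e * of_bool (grp e = j))) - (\<Sum>i<n. a i * (\<Sum>e\<in>E. w e * real (u e i)))"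
    by (simp only: sum_distrib_left sum.swap[of _ E])
  also have "\<dots> = (\<Sum>j<k. b j * T) - (\<Sum>i<n. a i * real (K i))"
    using represents_row[OF assms(1)] by simp
  finally show ?thesis by (simp add: objective_def sum_distrib_left mult.commute)
qed

lemma group_weighted_sum:
  assumes "represents w K"
  shows "(\<Sum>e\<in>E. w e * (\<Sum>j<k. D j * of_bool (grp e = j))) = T * (\<Sum>j<k. D j)"
proof -
  have "(\<Sum>e\<in>E. w e * (\<Sum>j<k. D j * of_bool (grp e = j))) =
      (\<Sum>e\<in>E. \<Sum>j<k. D j * (w e * of_bool (grp e = j)))"
    by (simp only: sum_distrib_left mult.left_commute[of "w _"])
  also have "\<dots> = (\<Sum>j<k. D j * (\<Sum>e\<in>E. w e * of_bool (grp e = j)))"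
    by (simp only: sum_distrib_left sum.swap[of _ E])
  also have "\<dots> = (\<Sum>j<k. D j * T)" using represents_row(2)[OF assms] by simp
  finally show ?thesis by (simp add: sum_distrib_left mult.commute)
qed

lemma group_sum_single: "j < k \<Longrightarrow> grp e = j \<Longrightarrow> (\<Sum>j<k. D j * of_bool (grp e = j)) = (D j :: real)"
  by (simp add: of_bool_def if_distrib cong: if_cong)

lemma represents_degree:
  assumes "represents w K"
  shows "real (expo_degree n K) = (\<Sum>e\<in>E. w e * real (expo_degree n (u e)))"
proof -
  have "(\<Sum>e\<in>E. w e * real (expo_degree n (u e))) = (\<Sum>e\<in>E. \<Sum>i<n. w e * real (u e i))"
    by (simp add: expo_degree_def sum_distrib_left)
  also have "\<dots> = (\<Sum>i<n. \<Sum>e\<in>E. w e * real (u e i))" by (rule sum.swap)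
  also have "\<dots> = (\<Sum>i<n. real (K i))" using represents_row(1)[OF assms] by simp
  finally show ?thesis by (simp add: expo_degree_def)
qed

text \<open>
The generators \<open>v\<close> of positive weight are tight. After concentrating the weights of group \<open>j\<close> and
mixing the result with the original weights, all generators of the support keep positive weight and
some \<open>v\<close> has weight greater than \<open>1\<close>. One unit of \<open>v\<close> may then be traded for one unit of another
generator \<open>e\<close> of the group; if this does not increase the objective, the new weights are again
optimal, and by maximality of the support \<open>e\<close> was in it, hence tight.
\<close>

theorem exchange_stable_generators:
  assumes "finite KS" "K0 \<in> KS" "represents w0 K0"
  shows "\<exists>K a b. K \<in> KS \<and> (\<forall>e\<in>E. slack a b e \<ge> 0) \<and> (\<forall>j\<ge>k. b j = 0) \<and>
    (\<forall>j<k. \<exists>v w. v \<in> E \<and> grp v = j \<and> slack a b v = 0 \<and> represents w K \<and> w v \<ge> 1 \<and>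
       objective y K w \<le> objective y K0 w0 \<and> (\<forall>i<n. u v i \<le> K i) \<and>
       (\<forall>e\<in>E. grp e = j \<longrightarrow> (\<lambda>i. K i - u v i + u e i) \<in> KS \<longrightarrow>
          y (\<lambda>i. K i - u v i + u e i) + cost e \<le> y K + cost v \<longrightarrow> slack a b e = 0))"
proof -
  obtain K w U a b where K: "K \<in> KS" and w: "represents w K" and U: "U = {e \<in> E. w e > 0}"
    and opt: "\<And>K' w'. K' \<in> KS \<Longrightarrow> represents w' K' \<Longrightarrow> objective y K w \<le> objective y K' w'"
    and maxi: "\<And>K' w'. K' \<in> KS \<Longrightarrow> represents w' K' \<Longrightarrow> objective y K' w' \<le> objective y K w \<Longrightarrow>
       card {e \<in> E. w' e > 0} \<le> card U"
    and tight: "\<And>e. e \<in> U \<Longrightarrow> slack a b e = 0" and nontight: "\<And>e. e \<in> E - U \<Longrightarrow> slack a b e > 0"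
    and b0: "\<And>j. j \<ge> k \<Longrightarrow> b j = 0"
    using strictly_complementary_optimum[OF assms, of y] by blast
  have finU: "finite U" using finite_E U by simp
  have "\<exists>v w. v \<in> E \<and> grp v = j \<and> slack a b v = 0 \<and> represents w K \<and> w v \<ge> 1 \<and>
       objective y K w \<le> objective y K0 w0 \<and> (\<forall>i<n. u v i \<le> K i) \<and>
       (\<forall>e\<in>E. grp e = j \<longrightarrow> (\<lambda>i. K i - u v i + u e i) \<in> KS \<longrightarrow>
          y (\<lambda>i. K i - u v i + u e i) + cost e \<le> y K + cost v \<longrightarrow> slack a b e = 0)" if j: "j < k" for j
  proof -
    define G where "G = {e \<in> U. grp e = j}"
    have G: "finite G" "G \<subseteq> E" "\<And>e. e \<in> G \<Longrightarrow> w e > 0" using finU U by (auto simp: G_def intro: finite_subset[OF _ finU])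
    have off: "w e = 0" if "e \<notin> U" for e
      using that w by (auto simp: U represents_def not_less intro: antisym)
    have "sum w G = T"
    proof -
      have "sum w G = (\<Sum>e\<in>G. w e * of_bool (grp e = j))" by (rule sum.cong) (auto simp: G_def)
      also have "\<dots> = (\<Sum>e\<in>E. w e * of_bool (grp e = j))"
        by (rule sum.mono_neutral_left) (use G finite_E off in \<open>auto simp: G_def\<close>)
      also have "\<dots> = T" using represents_row(2)[OF w j] .
      finally show ?thesis .
    qed
    then obtain w1 v where w1: "\<forall>e\<in>G. w1 e \<ge> 0"
      "\<forall>i<n. (\<Sum>e\<in>G. w1 e * real (u e i)) = (\<Sum>e\<in>G. w e * real (u e i))"
      "sum w1 G = sum w G" and v: "v \<in> G" "w1 v > 1"
      using concentrate_weights[of G w n "\<lambda>i e. real (u e i)"] G total_large by (auto simp: less_imp_le)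
    \<comment> \<open>With this share of the old weights, the concentrated weights contribute exactly \<open>1\<close> at \<open>v\<close>.\<close>
    define \<epsilon> where "\<epsilon> = 1 - 1 / w1 v"
    have \<epsilon>: "0 < \<epsilon>" "\<epsilon> < 1" using v(2) by (auto simp: \<epsilon>_def)
    define \<eta> where "\<eta> = (\<lambda>e. if e \<in> G then (1 - \<epsilon>) * (w1 e - w e) else 0)"
    define w2 where "w2 = (\<lambda>e. w e + \<eta> e)"
    have \<eta>_sum: "(\<Sum>e\<in>E. \<eta> e * g e) = (1 - \<epsilon>) * ((\<Sum>e\<in>G. w1 e * g e) - (\<Sum>e\<in>G. w e * g e))" for g
    proof -
      have "(\<Sum>e\<in>E. \<eta> e * g e) = (\<Sum>e\<in>G. \<eta> e * g e)"
        by (rule sum.mono_neutral_right) (use G finite_E in \<open>auto simp: \<eta>_def\<close>)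
      also have "\<dots> = (\<Sum>e\<in>G. (1 - \<epsilon>) * (w1 e * g e - w e * g e))"
        by (rule sum.cong) (auto simp: \<eta>_def algebra_simps)
      finally show ?thesis by (simp add: sum_subtractf sum_distrib_left[symmetric])
    qed
    have w2_G: "w2 e = (1 - \<epsilon>) * w1 e + \<epsilon> * w e" if "e \<in> G" for e
      using that by (simp add: w2_def \<eta>_def algebra_simps)
    have w2_pos: "w2 e > 0" if "e \<in> U" for e
    proof (cases "e \<in> G")
      case True
      then show ?thesis using w1(1) G(3) \<epsilon> by (simp add: w2_G add_nonneg_pos)
    next
      case False
      then show ?thesis using that by (simp add: w2_def \<eta>_def U)
    qed
    have w2_off: "w2 e = 0" if "e \<notin> U" for e
      using off[OF that] that by (simp add: w2_def \<eta>_def G_def)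
    have w2_rows: "(\<Sum>e\<in>E. w2 e * entry r e) = rhs K r" if r: "r \<in> rows" for r
    proof -
      have "(\<Sum>e\<in>G. w1 e * entry r e) = (\<Sum>e\<in>G. w e * entry r e)"
      proof (cases r)
        case (Inl i)
        then show ?thesis using r w1(2) by (auto simp: rows_def entry_def)
      next
        case (Inr j')
        have "(\<Sum>e\<in>G. x e * entry r e) = of_bool (j = j') * sum x G" for x
          unfolding sum_distrib_left by (rule sum.cong) (auto simp: Inr entry_def G_def)
        then show ?thesis using w1(3) by simp
      qed
      then have "(\<Sum>e\<in>E. \<eta> e * entry r e) = 0" by (simp add: \<eta>_sum)
      then show ?thesis using w r by (simp add: w2_def distrib_right sum.distrib represents_def)
    qed
    have w2: "represents w2 K" unfolding represents_def
      using w2_rows w2_pos w2_off U by (metis (no_types, lifting) less_imp_le mem_Collect_eq order_refl)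
    have obj2: "objective y K w2 = objective y K w"
    proof -
      have "slack a b e = 0" if "e \<in> E" "w2 e > 0 \<or> w e > 0" for e
        using tight[of e] w2_off[of e] off[of e] that by (cases "e \<in> U") auto
      then show ?thesis
        using slack_zero_objective[where a = a and b = b and y = y, OF w2 _ b0] slack_zero_objective[where a = a and b = b and y = y, OF w _ b0] by simp
    qed
    have vU: "v \<in> U" "v \<in> E" "grp v = j" using v(1) G by (auto simp: G_def)
    have w2v: "w2 v > 1" 
    proof -
      have "w2 v = 1 + \<epsilon> * w v" using w2_G[OF v(1)] v(2) by (simp add: \<epsilon>_def)
      then show ?thesis using \<epsilon>(1) G(3)[OF v(1)] by simp
    qed
    have uv: "u v i \<le> K i" if "i < n" for i
    proof -
      have "real (u v i) \<le> w2 v * real (u v i)" using w2v by (simp add: mult_le_cancel_right1)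
      also have "\<dots> \<le> (\<Sum>e\<in>E. w2 e * real (u e i))"
        by (rule member_le_sum) (use vU finite_E w2 in \<open>auto simp: represents_def\<close>)
      finally show ?thesis using represents_row(1)[OF w2 that] by simp
    qed
    have "slack a b e = 0"
      if e: "e \<in> E" "grp e = j" and K': "(\<lambda>i. K i - u v i + u e i) \<in> KS"
        "y (\<lambda>i. K i - u v i + u e i) + cost e \<le> y K + cost v" for e
    proof -
      define K' where "K' = (\<lambda>i. K i - u v i + u e i)"
      define w3 where "w3 = (\<lambda>x. w2 x - of_bool (x = v) + of_bool (x = e))"
      have single: "(\<Sum>x\<in>E. of_bool (x = z) * g x) = g z" if "z \<in> E" for z and g :: "'e \<Rightarrow> real"
        using that finite_E by (simp add: of_bool_def if_distrib[of "\<lambda>x. x * _"] cong: if_cong)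
      have w3_sum: "(\<Sum>x\<in>E. w3 x * g x) = (\<Sum>x\<in>E. w2 x * g x) - g v + g e" for g
        by (simp add: w3_def distrib_right left_diff_distrib sum.distrib sum_subtractf
            single[OF vU(2)] single[OF e(1)])
      have "(\<Sum>x\<in>E. w3 x * entry r x) = rhs K' r" if r: "r \<in> rows" for r
      proof (cases r)
        case (Inl i)
        then show ?thesis using r w2_rows[OF r] uv[of i]
          by (auto simp: w3_sum entry_def rhs_def K'_def rows_def of_nat_diff)
      next
        case (Inr j')
        then show ?thesis using w2_rows[OF r] e vU by (simp add: w3_sum entry_def rhs_def)
      qed
      moreover have w3_pos: "w3 x > 0" if "x \<in> insert e U" for x
        using that w2_pos[of x] w2v w2_off[of x] vU by (cases "x \<in> U") (auto simp: w3_def of_bool_def)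
      moreover have w3_off: "w3 x = 0" if "x \<notin> insert e U" for x
        using that w2_off[of x] vU by (auto simp: w3_def)
      ultimately have w3: "represents w3 K'" unfolding represents_def
        using e U by (metis (no_types, lifting) insert_iff less_imp_le mem_Collect_eq order_refl)
      have "objective y K' w3 \<le> objective y K w2"
        using K'(2) by (simp add: objective_def w3_sum K'_def)
      then have "card {x \<in> E. w3 x > 0} \<le> card U"
        using maxi[OF _ w3] K'(1) obj2 by (simp add: K'_def)
      moreover have "insert e U \<subseteq> {x \<in> E. w3 x > 0}" using w3_pos e U by auto
      then have "card (insert e U) \<le> card {x \<in> E. w3 x > 0}"
        by (intro card_mono) (use finite_E in auto)
      ultimately have "e \<in> U" using finU by (cases "e \<in> U") auto
      then show ?thesis by (rule tight)
    qed
    moreover have "objective y K w2 \<le> objective y K0 w0" using obj2 opt[OF assms(2,3)] by simp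
    ultimately show ?thesis using vU(2,3) tight[OF vU(1)] w2 less_imp_le[OF w2v] uv
      by (intro exI[of _ v] exI[of _ w2] conjI ballI impI allI)
  qed
  moreover have "slack a b e \<ge> 0" if "e \<in> E" for e
    using tight[of e] nontight[of e] that by (cases "e \<in> U") auto
  ultimately show ?thesis using K b0 by (intro exI[of _ K] exI[of _ a] exI[of _ b]) simp
qed

end

section \<open>Macaulay rows and tropical evaluation\<close>

lemma trop_real_subset: "trop_real \<subseteq> trop_real_inf"
  by (auto simp: trop_real_def trop_real_inf_def)

lemma trop_real_iff: "x \<in> trop_real \<longleftrightarrow> x \<noteq> \<infinity> \<and> x \<noteq> -\<infinity>"
  by (cases x) (auto simp: trop_real_def)

lemma trop_real_inf_iff: "x \<in> trop_real_inf \<longleftrightarrow> x \<noteq> -\<infinity>"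
  by (cases x) (auto simp: trop_real_inf_def)

lemma minplus_system_mono: "minplus_system K n F \<Longrightarrow> K \<subseteq> K' \<Longrightarrow> minplus_system K' n F"
  unfolding minplus_system_def is_trop_poly_def by blast

lemma mac_solution_mono: "mac_solution K n F N y \<Longrightarrow> K \<subseteq> K' \<Longrightarrow> mac_solution K' n F N y"
  unfolding mac_solution_def by blast

lemma finite_mac_cols: "finite (mac_cols n N)"
proof (rule finite_subset)
  show "mac_cols n N \<subseteq> {I. \<forall>i. (i \<in> {..<n} \<longrightarrow> I i \<in> {..N}) \<and> (i \<notin> {..<n} \<longrightarrow> I i = 0)}"
  proof (intro subsetI CollectI allI conjI impI)
    fix I i assume I: "I \<in> mac_cols n N" and i: "i \<in> {..<n}"
    have "I i \<le> expo_degree n I" unfolding expo_degree_def by (rule member_le_sum) (use i in auto)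
    then show "I i \<in> {..N}" using I by (simp add: mac_cols_def)
  next
    fix I i assume "I \<in> mac_cols n N" "i \<notin> {..<n}"
    then show "I i = 0" by (simp add: mac_cols_def expos_def)
  qed
qed (intro finite_set_of_finite_funs; simp)

lemma zero_mac_cols: "(\<lambda>_. 0) \<in> mac_cols n N"
  by (simp add: mac_cols_def expos_def expo_degree_def)

lemma expo_degree_add: "expo_degree n (\<lambda>i. I i + J i) = expo_degree n I + expo_degree n J"
  by (simp add: expo_degree_def sum.distrib)

text \<open>
The two members of a pair play symmetric roles; addressing them by a truth value lets every argument
about one side apply to the other side as well.
\<close>

definition side :: "bool \<Rightarrow> minplus_poly \<Rightarrow> trop_poly" where
  "side s P = (if s then fst P else snd P)"

lemma side_is_trop_poly:
  "minplus_system K n F \<Longrightarrow> j < length F \<Longrightarrow> is_trop_poly K n (side s (F ! j))"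
  by (auto simp: minplus_system_def side_def)

lemma side_degree: "trop_degree n (side s P) \<le> minplus_degree n P"
  by (auto simp: side_def minplus_degree_def)

lemma trop_coeff_finite:
  assumes "is_trop_poly K n f" "trop_coeff f I \<noteq> \<infinity>"
  shows "I \<in> dom f" "I \<in> expos n" "expo_degree n I \<le> trop_degree n f" "the (f I) = trop_coeff f I"
proof -
  show I: "I \<in> dom f" using assms(2) by (auto simp: trop_coeff_def split: option.splits)
  then show "I \<in> expos n" "the (f I) = trop_coeff f I" using assms(1) by (auto simp: is_trop_poly_def trop_coeff_def)
  show "expo_degree n I \<le> trop_degree n f"
    unfolding trop_degree_def using I assms(1) by (intro Max_ge) (auto simp: is_trop_poly_def)
qed

lemma trop_coeff_dom: "I \<in> dom f \<Longrightarrow> the (f I) = trop_coeff f I"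
  by (auto simp: trop_coeff_def)

lemma trop_coeff_in:
  assumes "is_trop_poly K n f" "K \<subseteq> trop_real_inf"
  shows "trop_coeff f I \<noteq> -\<infinity>"
proof (cases "f I")
  case (Some c)
  then have "c \<in> K" using assms(1) by (auto simp: is_trop_poly_def ran_def)
  then show ?thesis using assms(2) Some by (auto simp: trop_coeff_def trop_real_inf_iff[symmetric])
qed (simp add: trop_coeff_def)

lemma trop_coeff_shift:
  "trop_coeff (trop_shift J f) I = (if J \<le> I then trop_coeff f (I - J) else \<infinity>)"
  by (simp add: trop_coeff_def trop_shift_def)

lemma expo_sub_add: "J \<le> I \<Longrightarrow> (\<lambda>i. (I - J) i + J i) = (I :: expo)"
  by (auto simp: le_fun_def)

lemma mac_row_mem:
  assumes "minplus_system K n F" "j < length F" "J \<in> expos n"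
    "expo_degree n J + minplus_degree n (F ! j) \<le> N"
  shows "(j, J) \<in> mac_rows n F N"
proof -
  have "I \<in> mac_cols n N"
    if I: "I \<in> expos n" and fin: "trop_coeff (trop_shift J (side s (F ! j))) I \<noteq> \<infinity>" for I s
  proof -
    have J: "J \<le> I" "trop_coeff (side s (F ! j)) (I - J) \<noteq> \<infinity>"
      using fin by (auto simp: trop_coeff_shift split: if_splits)
    have "expo_degree n I = expo_degree n (I - J) + expo_degree n J"
      using expo_degree_add[of n "I - J" J] by (simp only: expo_sub_add[OF J(1)])
    moreover have "expo_degree n (I - J) \<le> minplus_degree n (F ! j)"
      using trop_coeff_finite(3)[OF side_is_trop_poly[OF assms(1,2)] J(2)] side_degree[of n s "F ! j"] by linarith
    ultimately show ?thesis using assms(4) I by (simp add: mac_cols_def)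
  qed
  from this[of _ True] this[of _ False] show ?thesis
    using assms(2,3) by (auto simp: mac_rows_def Ml_def Mr_def side_def)
qed

lemma solution_sides:
  assumes "mac_solution K n F N y" "(j, J) \<in> mac_rows n F N"
  shows "Min ((\<lambda>I. trop_coeff (trop_shift J (side s (F ! j))) I + y I) ` mac_cols n N) =
         Min ((\<lambda>I. trop_coeff (trop_shift J (side (\<not> s) (F ! j))) I + y I) ` mac_cols n N)"
proof -
  have "trop_mat_vec (mac_cols n N) (Ml F) y (j, J) = trop_mat_vec (mac_cols n N) (Mr F) y (j, J)"
    using assms by (simp add: mac_solution_def)
  then show ?thesis by (cases s) (simp_all add: trop_mat_vec_def Ml_def Mr_def side_def)
qed

text \<open>
Row \<open>(j, K - I)\<close> of the Macaulay system contains the monomial \<open>I\<close> of one side in column \<open>K\<close>. The minimum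
over the other side is attained at some column, which has the form \<open>K - I + I'\<close> for a monomial \<open>I'\<close> of
that side, and is no larger than the entry at \<open>K\<close>.
\<close>

lemma macaulay_exchange:
  assumes "minplus_system trop_real_inf n F" "mac_solution trop_real_inf n F N y" "j < length F"
    and I: "trop_coeff (side s (F ! j)) I \<noteq> \<infinity>"
    and K: "K \<in> mac_cols n N" "y K \<noteq> \<infinity>" "\<forall>i<n. I i \<le> K i"
    and deg: "expo_degree n (\<lambda>i. K i - I i) + minplus_degree n (F ! j) \<le> N"
  obtains I' where "trop_coeff (side (\<not> s) (F ! j)) I' \<noteq> \<infinity>"
    "(\<lambda>i. K i - I i + I' i) \<in> mac_cols n N" "y (\<lambda>i. K i - I i + I' i) \<noteq> \<infinity>"
    "real_of_ereal (y (\<lambda>i. K i - I i + I' i)) + real_of_ereal (trop_coeff (side (\<not> s) (F ! j)) I')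
      \<le> real_of_ereal (y K) + real_of_ereal (trop_coeff (side s (F ! j)) I)"
proof -
  define J where "J = (\<lambda>i. K i - I i)"
  note poly = side_is_trop_poly[OF assms(1,3)]
  have IK: "I \<le> K"
    using K(3) trop_coeff_finite(2)[OF poly I] unfolding le_fun_def expos_def
    by (metis (mono_tags, lifting) mem_Collect_eq not_less zero_le)
  have J: "J \<le> K" "K - J = I" "J \<in> expos n"
    using IK K(1) by (auto simp: J_def le_fun_def fun_eq_iff mac_cols_def expos_def)
  have row: "(j, J) \<in> mac_rows n F N"
    using mac_row_mem[OF assms(1,3) J(3)] deg by (simp add: J_def)
  define L where "L = (\<lambda>s I. trop_coeff (trop_shift J (side s (F ! j))) I + y I)"
  have ne: "L (\<not> s) ` mac_cols n N \<noteq> {}" using K(1) by auto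
  obtain c where c: "c \<in> mac_cols n N" "Min (L (\<not> s) ` mac_cols n N) = L (\<not> s) c"
    using Min_in[OF _ ne] finite_mac_cols by auto
  have "L (\<not> s) c = Min (L s ` mac_cols n N)"
    using solution_sides[OF assms(2) row, of s] c(2) by (simp add: L_def)
  also have "\<dots> \<le> L s K" using K(1) finite_mac_cols by (intro Min_le) auto
  also have "L s K = trop_coeff (side s (F ! j)) I + y K" using J by (simp add: L_def trop_coeff_shift)
  finally have le: "L (\<not> s) c \<le> trop_coeff (side s (F ! j)) I + y K" .
  have fin: "trop_coeff (side s (F ! j)) I \<noteq> -\<infinity>" "y K \<noteq> -\<infinity>" "y c \<noteq> -\<infinity>"
    "trop_coeff (side (\<not> s) (F ! j)) (c - J) \<noteq> -\<infinity>"
    using trop_coeff_in[OF poly] assms(2) K(1) c(1)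
    by (auto simp: mac_solution_def trop_real_inf_iff)
  have "L (\<not> s) c \<noteq> \<infinity>" using le I K(2) by auto
  then have c2: "J \<le> c" "trop_coeff (side (\<not> s) (F ! j)) (c - J) \<noteq> \<infinity>" "y c \<noteq> \<infinity>"
    using fin by (auto simp: L_def trop_coeff_shift split: if_splits)
  have cc: "(\<lambda>i. K i - I i + (c - J) i) = c"
    using c2(1) by (auto simp: J_def le_fun_def fun_eq_iff)
  have "trop_coeff (side (\<not> s) (F ! j)) (c - J) + y c \<le> trop_coeff (side s (F ! j)) I + y K"
    using le c2(1) by (simp add: L_def trop_coeff_shift)
  then have "real_of_ereal (y c) + real_of_ereal (trop_coeff (side (\<not> s) (F ! j)) (c - J))
      \<le> real_of_ereal (y K) + real_of_ereal (trop_coeff (side s (F ! j)) I)"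
    using fin c2 I K(2)
    by (cases "trop_coeff (side (\<not> s) (F ! j)) (c - J)"; cases "y c"; cases "y K";
        cases "trop_coeff (side s (F ! j)) I") auto
  then show ?thesis using that[of "c - J", unfolded cc] c(1) c2 by blast
qed

text \<open>
Coordinates that do not occur in \<open>I\<close> may be infinite; this covers points whose infinite coordinates
are avoided by the monomial.
\<close>

lemma expo_eval_real:
  assumes "\<And>i. i < n \<Longrightarrow> x i = ereal (a i) \<or> I i = 0"
  shows "expo_eval n I x = ereal (\<Sum>i<n. a i * real (I i))"
proof -
  have "ereal (real (I i)) * x i = ereal (a i * real (I i))" if "i < n" for i
    using assms[OF that]
  proof
    assume "I i = 0"
    then show ?thesis by (simp flip: zero_ereal_def)
  qed (simp add: mult.commute)
  then have "expo_eval n I x = (\<Sum>i<n. ereal (a i * real (I i)))"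
    unfolding expo_eval_def by (intro sum.cong) auto
  then show ?thesis by simp
qed

lemma expo_eval_infinite:
  assumes "i < n" "I i > 0" "x i = \<infinity>"
  shows "expo_eval n I x = \<infinity>"
proof -
  have "ereal (real (I i)) * x i = \<infinity>" using assms by simp
  then show ?thesis unfolding expo_eval_def sum_Pinfty using assms(1) by blast
qed

lemma expo_eval_not_MInfty:
  assumes "\<And>i. i < n \<Longrightarrow> x i \<noteq> -\<infinity>"
  shows "expo_eval n I x \<noteq> -\<infinity>"
proof (cases "\<exists>i<n. I i > 0 \<and> x i = \<infinity>")
  case True
  then obtain i where "i < n" "I i > 0" "x i = \<infinity>" by blast
  then show ?thesis using expo_eval_infinite[of i n I x] by simp
next
  case False
  have "x i = ereal (real_of_ereal (x i)) \<or> I i = 0" if "i < n" for i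
    using False assms[OF that] that by (cases "x i") auto
  then have "expo_eval n I x = ereal (\<Sum>i<n. real_of_ereal (x i) * real (I i))"
    by (rule expo_eval_real)
  then show ?thesis by simp
qed

lemma expo_eval_add: "expo_eval n (\<lambda>i. I i + J i) x = expo_eval n I x + expo_eval n J x"
proof -
  have "ereal (real (I i + J i)) * x i = ereal (real (I i)) * x i + ereal (real (J i)) * x i" for i
  proof -
    have "(ereal (real (I i)) + ereal (real (J i))) * x i = ereal (real (I i)) * x i + ereal (real (J i)) * x i"
      by (rule ereal_left_distrib) auto
    then show ?thesis by (simp only: of_nat_add plus_ereal.simps)
  qed
  then show ?thesis by (simp add: expo_eval_def sum.distrib)
qed

text \<open>
Truncating the columns loses nothing in a row of the truncated matrix, since by definition all its
finite entries lie in the retained columns.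
\<close>

lemma shifted_eval:
  assumes f: "is_trop_poly K n f" "K \<subseteq> trop_real_inf" and x: "\<And>i. i < n \<Longrightarrow> x i \<noteq> -\<infinity>"
    and J: "J \<in> expos n"
    and cols: "\<And>I. I \<in> expos n \<Longrightarrow> trop_coeff (trop_shift J f) I \<noteq> \<infinity> \<Longrightarrow> I \<in> mac_cols n N"
  shows "Min ((\<lambda>I. trop_coeff (trop_shift J f) I + expo_eval n I x) ` mac_cols n N) =
    trop_eval n f x + expo_eval n J x" (is "Min (?g ` _) = _")
proof (rule antisym)
  note nm = expo_eval_not_MInfty[of n x, OF x]
  have fin: "finite (dom f)" "dom f \<noteq> {}" using f by (auto simp: is_trop_poly_def)
  show "Min (?g ` mac_cols n N) \<le> trop_eval n f x + expo_eval n J x"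
  proof -
    have "trop_eval n f x \<in> (\<lambda>I. the (f I) + expo_eval n I x) ` dom f"
      unfolding trop_eval_def by (rule Min_in) (use fin in auto)
    then obtain I where I: "I \<in> dom f" "trop_eval n f x = trop_coeff f I + expo_eval n I x"
      by (auto simp: trop_coeff_dom)
    show ?thesis
    proof (cases "trop_coeff f I = \<infinity>")
      case False
      define I' where "I' = (\<lambda>i. I i + J i)"
      have sh: "J \<le> I'" "I' - J = I" by (auto simp: I'_def le_fun_def fun_eq_iff)
      have "I' \<in> expos n" using trop_coeff_finite(2)[OF f(1) False] J by (auto simp: I'_def expos_def)
      then have "I' \<in> mac_cols n N" using cols[of I'] sh False by (simp add: trop_coeff_shift)
      then have "Min (?g ` mac_cols n N) \<le> ?g I'" using finite_mac_cols by (intro Min_le) auto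
      also have "\<dots> = trop_coeff f I + (expo_eval n I x + expo_eval n J x)"
        using sh by (simp add: trop_coeff_shift expo_eval_add I'_def)
      finally show ?thesis using I(2) by (simp add: add.assoc)
    qed (use I(2) nm in auto)
  qed
  show "trop_eval n f x + expo_eval n J x \<le> Min (?g ` mac_cols n N)"
  proof (rule Min.boundedI)
    fix z assume "z \<in> ?g ` mac_cols n N"
    then obtain I where I: "I \<in> mac_cols n N" "z = ?g I" by blast
    show "trop_eval n f x + expo_eval n J x \<le> z"
    proof (cases "trop_coeff (trop_shift J f) I = \<infinity>")
      case False
      then have sh: "J \<le> I" "trop_coeff f (I - J) \<noteq> \<infinity>" by (auto simp: trop_coeff_shift split: if_splits)
      have "trop_eval n f x \<le> trop_coeff f (I - J) + expo_eval n (I - J) x"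
        unfolding trop_eval_def trop_coeff_finite(4)[OF f(1) sh(2), symmetric]
        using fin(1) trop_coeff_finite(1)[OF f(1) sh(2)] by (intro Min_le) auto
      then have "trop_eval n f x + expo_eval n J x \<le>
          trop_coeff f (I - J) + expo_eval n (I - J) x + expo_eval n J x" by (rule add_right_mono)
      also have "\<dots> = trop_coeff f (I - J) + expo_eval n (\<lambda>i. (I - J) i + J i) x"
        by (simp only: expo_eval_add add.assoc)
      also have "\<dots> = z" using sh(1) I(2) by (simp only: expo_sub_add trop_coeff_shift if_True)
      finally show ?thesis .
    qed (use I(2) nm in auto)
  next
    show "?g ` mac_cols n N \<noteq> {}" using zero_mac_cols by blast
  qed (simp add: finite_mac_cols)
qed

lemma solution_of_root:
  assumes sys: "minplus_system K n F" "K \<subseteq> trop_real_inf" and root: "system_root K n F x"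
    and closed: "\<And>I. expo_eval n I x \<in> K"
  shows "mac_solution K n F N (\<lambda>I. expo_eval n I x)"
  unfolding mac_solution_def
proof (intro conjI ballI closed)
  fix r assume r: "r \<in> mac_rows n F N"
  obtain j J where jJ: "r = (j, J)" by (cases r)
  have j: "j < length F" and J: "J \<in> expos n"
    and cols: "\<And>I s. I \<in> expos n \<Longrightarrow> trop_coeff (trop_shift J (side s (F ! j))) I \<noteq> \<infinity> \<Longrightarrow> I \<in> mac_cols n N"
    using r by (auto simp: jJ mac_rows_def Ml_def Mr_def side_def split: if_splits)
  have x: "x i \<noteq> -\<infinity>" if "i < n" for i
    using root sys(2) that by (auto simp: system_root_def trop_real_inf_iff[symmetric])
  have eq: "Min ((\<lambda>I. trop_coeff (trop_shift J (side s (F ! j))) I + expo_eval n I x) ` mac_cols n N) =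
      trop_eval n (side s (F ! j)) x + expo_eval n J x" for s
    by (rule shifted_eval[OF side_is_trop_poly[OF sys(1) j] sys(2) x J cols])
  have "trop_eval n (side True (F ! j)) x = trop_eval n (side False (F ! j)) x"
    using root j by (simp add: system_root_def side_def)
  then show "trop_mat_vec (mac_cols n N) (Ml F) (\<lambda>I. expo_eval n I x) r =
      trop_mat_vec (mac_cols n N) (Mr F) (\<lambda>I. expo_eval n I x) r"
    using eq[of True] eq[of False] by (simp add: trop_mat_vec_def Ml_def Mr_def jJ side_def)
qed

lemma trop_eval_eqI:
  assumes "is_trop_poly K n f" "\<And>I. I \<in> dom f \<Longrightarrow> B \<le> trop_coeff f I + expo_eval n I x"
    "I0 \<in> dom f" "trop_coeff f I0 + expo_eval n I0 x = B"
  shows "trop_eval n f x = B"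
  unfolding trop_eval_def
proof (rule Min_eqI)
  show "B \<in> (\<lambda>I. the (f I) + expo_eval n I x) ` dom f"
    using assms(3,4) by (intro image_eqI[of _ _ I0]) (auto simp: trop_coeff_dom)
  show "finite ((\<lambda>I. the (f I) + expo_eval n I x) ` dom f)" using assms(1) by (simp add: is_trop_poly_def)
  fix z assume "z \<in> (\<lambda>I. the (f I) + expo_eval n I x) ` dom f"
  then obtain I where "I \<in> dom f" "z = trop_coeff f I + expo_eval n I x" by (auto simp: trop_coeff_dom)
  then show "B \<le> z" using assms(2) by simp
qed

lemma system_rootI:
  assumes "\<And>i. i < n \<Longrightarrow> x i \<in> K"
    and "\<And>j. j < length F \<Longrightarrow> trop_eval n (side True (F ! j)) x = trop_eval n (side False (F ! j)) x"
  shows "system_root K n F x"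
proof -
  have "trop_eval n (fst P) x = trop_eval n (snd P) x" if P: "P \<in> set F" for P
  proof -
    obtain j where "j < length F" "F ! j = P" using P by (auto simp: in_set_conv_nth)
    then show ?thesis using assms(2)[of j] by (simp add: side_def)
  qed
  then show ?thesis using assms(1) by (simp add: system_root_def)
qed

section \<open>From solutions to roots over the reals\<close>

text \<open>
\<open>Side j s I\<close> is the monomial with exponent \<open>I\<close> on side \<open>s\<close> of pair \<open>j\<close>; monomials of the two sides with the
same exponent are kept apart. \<open>Const j\<close> and \<open>Unit i\<close> are the auxiliary generators needed over the
semiring with infinity.
\<close>

datatype gen = Side nat bool expo | Const nat | Unit nat

primrec gen_expo :: "gen \<Rightarrow> expo" where
  "gen_expo (Side j s I) = I"
| "gen_expo (Const j) = (\<lambda>_. 0)"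
| "gen_expo (Unit i) = (\<lambda>i'. of_bool (i' = i))"

primrec gen_group :: "nat \<Rightarrow> gen \<Rightarrow> nat" where
  "gen_group k (Side j s I) = j"
| "gen_group k (Const j) = j"
| "gen_group k (Unit i) = k"

primrec gen_cost :: "minplus_poly list \<Rightarrow> real \<Rightarrow> real \<Rightarrow> gen \<Rightarrow> real" where
  "gen_cost F \<kappa> \<tau> (Side j s I) = real_of_ereal (trop_coeff (side s (F ! j)) I)"
| "gen_cost F \<kappa> \<tau> (Const j) = \<kappa>"
| "gen_cost F \<kappa> \<tau> (Unit i) = \<tau>"

definition side_gens :: "minplus_poly list \<Rightarrow> gen set" where
  "side_gens F = {Side j s I | j s I. j < length F \<and> trop_coeff (side s (F ! j)) I \<noteq> \<infinity>}"

lemma finite_side_gens: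
  assumes "minplus_system K n F"
  shows "finite (side_gens F)"
proof (rule finite_subset)
  show "side_gens F \<subseteq> (\<Union>j<length F. \<Union>s. Side j s ` dom (side s (F ! j)))"
    using trop_coeff_finite(1)[OF side_is_trop_poly[OF assms]] by (fastforce simp: side_gens_def)
  have "finite (dom (side s (F ! j)))" if "j < length F" for j s
    using side_is_trop_poly[OF assms that] by (simp add: is_trop_poly_def)
  then show "finite (\<Union>j<length F. \<Union>s. Side j s ` dom (side s (F ! j)))" by simp
qed

text \<open>
With the monomials as generators, every representable \<open>K\<close> has degree at most \<open>N\<close>, and \<open>K\<close> minus a monomial
of weight at least \<open>1\<close> in group \<open>j\<close> leaves room for the degree of pair \<open>j\<close>. The exchange property turns
a tight monomial on one side into a tight monomial on the other side, so both sides have value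
\<open>b j\<close> at the point \<open>a\<close>.
\<close>

theorem root_of_real_solution:
  assumes sys: "minplus_system trop_real n F" and N: "N = (n + 2) * (\<Sum>P\<leftarrow>F. minplus_degree n P)"
    and sol: "mac_solution trop_real n F N y"
  shows "\<exists>x. system_root trop_real n F x"
proof -
  define k where "k = length F"
  note sys' = minplus_system_mono[OF sys trop_real_subset]
  note sol' = mac_solution_mono[OF sol trop_real_subset]
  define E where "E = side_gens F"
  define D where "D = (\<lambda>j. real (minplus_degree n (F ! j)))"
  have N_real: "real N = (real n + 2) * (\<Sum>j<k. D j)"
    by (simp add: N D_def k_def sum_list_sum_nth atLeast0LessThan algebra_simps)
  interpret weighted_generators E n k "real n + 2" gen_expo "gen_cost F 0 0" "gen_group k"
    by unfold_locales (use finite_side_gens[OF sys] in \<open>auto simp: E_def side_gens_def k_def\<close>)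
  have degE: "real (expo_degree n (gen_expo e)) \<le> (\<Sum>j<k. D j * of_bool (gen_group k e = j))"
    if eE: "e \<in> E" for e
  proof -
    obtain j s I where e: "e = Side j s I" "j < k" "trop_coeff (side s (F ! j)) I \<noteq> \<infinity>"
      using eE by (auto simp: E_def side_gens_def k_def)
    have "expo_degree n I \<le> minplus_degree n (F ! j)"
      using trop_coeff_finite(3)[OF side_is_trop_poly[OF sys] e(3)] side_degree[of n s "F ! j"] e(2)
      by (simp add: k_def)
    then show ?thesis using group_sum_single[of j e D] e by (simp add: D_def)
  qed
  have deg_le: "expo_degree n K \<le> N" if "represents w K" for w K
  proof -
    have "real (expo_degree n K) \<le> (\<Sum>e\<in>E. w e * (\<Sum>j<k. D j * of_bool (gen_group k e = j)))"
      unfolding represents_degree[OF that]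
      by (intro sum_mono mult_left_mono degE) (use that in \<open>auto simp: represents_def\<close>)
    then show ?thesis using group_weighted_sum[OF that, of D] N_real by simp
  qed
  have "\<exists>I. trop_coeff (side True (F ! j)) I \<noteq> \<infinity>" if "j < k" for j
  proof -
    have p: "is_trop_poly trop_real n (side True (F ! j))"
      using side_is_trop_poly[OF sys] that by (simp add: k_def)
    then have "dom (side True (F ! j)) \<noteq> {}" unfolding is_trop_poly_def by blast
    then obtain I c where "side True (F ! j) I = Some c" by blast
    moreover then have "c \<in> trop_real" using p by (auto simp: is_trop_poly_def ran_def)
    ultimately show ?thesis by (auto simp: trop_coeff_def trop_real_iff intro!: exI[of _ I])
  qed
  then obtain I0 where I0: "\<And>j. j < k \<Longrightarrow> trop_coeff (side True (F ! j)) (I0 j) \<noteq> \<infinity>" by metis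
  define E0 where "E0 = (\<lambda>j. Side j True (I0 j)) ` {..<k}"
  define w0 where "w0 = (\<lambda>e. (real n + 2) * of_bool (e \<in> E0))"
  define K0 where "K0 = (\<lambda>i. (n + 2) * (\<Sum>j<k. I0 j i))"
  have E0: "E0 \<subseteq> E" using I0 by (auto simp: E0_def E_def side_gens_def k_def)
  have w0_sum: "(\<Sum>e\<in>E. w0 e * g e) = (real n + 2) * (\<Sum>j<k. g (Side j True (I0 j)))" for g
  proof -
    have "(\<Sum>e\<in>E. w0 e * g e) = (\<Sum>e\<in>E0. w0 e * g e)"
      by (rule sum.mono_neutral_right) (use E0 finite_E in \<open>auto simp: w0_def\<close>)
    also have "\<dots> = (\<Sum>j<k. (real n + 2) * g (Side j True (I0 j)))"
      unfolding E0_def by (subst sum.reindex) (auto simp: inj_on_def w0_def E0_def)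
    finally show ?thesis by (simp add: sum_distrib_left)
  qed
  have rep0: "represents w0 K0"
    unfolding represents_def
  proof (intro conjI ballI allI impI)
    fix r assume "r \<in> rows"
    then show "(\<Sum>e\<in>E. w0 e * entry r e) = rhs K0 r"
      unfolding w0_sum
      by (auto simp: rows_def entry_def rhs_def K0_def distrib_right)
  qed (use E0 in \<open>auto simp: w0_def\<close>)
  have "K0 i = 0" if "i \<ge> n" for i
  proof -
    have "I0 j i = 0" if "j < k" for j
      using trop_coeff_finite(2)[OF side_is_trop_poly[OF sys] I0[OF that]] \<open>i \<ge> n\<close> that
      by (simp add: expos_def k_def)
    then show ?thesis by (simp add: K0_def)
  qed
  then have K0: "K0 \<in> mac_cols n N" using deg_le[OF rep0] by (simp add: mac_cols_def expos_def)
  obtain K a b where K: "K \<in> mac_cols n N" and slack: "\<forall>e\<in>E. slack a b e \<ge> 0"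
    and ex: "\<forall>j<k. \<exists>v w. v \<in> E \<and> gen_group k v = j \<and> slack a b v = 0 \<and> represents w K \<and> w v \<ge> 1 \<and>
       objective (\<lambda>K. real_of_ereal (y K)) K w \<le> objective (\<lambda>K. real_of_ereal (y K)) K0 w0 \<and>
       (\<forall>i<n. gen_expo v i \<le> K i) \<and>
       (\<forall>e\<in>E. gen_group k e = j \<longrightarrow> (\<lambda>i. K i - gen_expo v i + gen_expo e i) \<in> mac_cols n N \<longrightarrow>
          real_of_ereal (y (\<lambda>i. K i - gen_expo v i + gen_expo e i)) + gen_cost F 0 0 e
            \<le> real_of_ereal (y K) + gen_cost F 0 0 v \<longrightarrow> slack a b e = 0)"
    using exchange_stable_generators[OF finite_mac_cols K0 rep0, of "\<lambda>K. real_of_ereal (y K)"]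
    by (elim exE conjE) (rule that)
  have tight: "\<exists>I. trop_coeff (side s (F ! j)) I \<noteq> \<infinity> \<and> slack a b (Side j s I) = 0" if j: "j < k" for j s
  proof -
    obtain v w where v: "v \<in> E" "gen_group k v = j" "slack a b v = 0" and w: "represents w K" "w v \<ge> 1"
      and vK: "\<forall>i<n. gen_expo v i \<le> K i"
      and exch: "\<forall>e\<in>E. gen_group k e = j \<longrightarrow> (\<lambda>i. K i - gen_expo v i + gen_expo e i) \<in> mac_cols n N \<longrightarrow>
          real_of_ereal (y (\<lambda>i. K i - gen_expo v i + gen_expo e i)) + gen_cost F 0 0 e
            \<le> real_of_ereal (y K) + gen_cost F 0 0 v \<longrightarrow> slack a b e = 0"
      using ex[rule_format, OF j] by (elim exE conjE) (rule that)
    obtain s' I where vI: "v = Side j s' I" "trop_coeff (side s' (F ! j)) I \<noteq> \<infinity>"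
      using v(1,2) by (auto simp: E_def side_gens_def)
    show ?thesis
    proof (cases "s = s'")
      case True
      then show ?thesis using vI v by auto
    next
      case False
      then have s: "s = (\<not> s')" by simp
      have "expo_degree n (\<lambda>i. K i - I i) + expo_degree n I = expo_degree n K"
        unfolding expo_degree_add[symmetric] using vK vI(1) by (simp add: expo_degree_def)
      moreover have "real (expo_degree n K) - real (expo_degree n I) + D j \<le> real N"
      proof -
        \<comment> \<open>The amount by which a monomial falls short of the degree of its pair; the weighted sum of these amounts is \<open>N\<close> minus the degree of \<open>K\<close>.\<close>
        define g where "g = (\<lambda>e. (\<Sum>j<k. D j * of_bool (gen_group k e = j)) - real (expo_degree n (gen_expo e)))"
        have "g v \<le> w v * g v" using degE[OF v(1)] w(2) by (simp add: g_def mult_le_cancel_right1)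
        also have "\<dots> \<le> (\<Sum>e\<in>E. w e * g e)"
          by (rule member_le_sum) (use v w degE finite_E in \<open>auto simp: g_def represents_def\<close>)
        also have "\<dots> = real N - real (expo_degree n K)"
          by (simp only: g_def right_diff_distrib sum_subtractf group_weighted_sum[OF w(1)]
              represents_degree[OF w(1), symmetric] N_real)
        finally show ?thesis using group_sum_single[OF j v(2), of D] vI(1) by (simp add: g_def)
      qed
      ultimately have dg: "expo_degree n (\<lambda>i. K i - I i) + minplus_degree n (F ! j) \<le> N"
        by (simp add: D_def)
      have yK: "y K \<noteq> \<infinity>" using sol K by (auto simp: mac_solution_def trop_real_iff)
      have IK: "\<forall>i<n. I i \<le> K i" using vK vI by simp
      obtain I' where I': "trop_coeff (side (\<not> s') (F ! j)) I' \<noteq> \<infinity>"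
        "(\<lambda>i. K i - I i + I' i) \<in> mac_cols n N"
        "real_of_ereal (y (\<lambda>i. K i - I i + I' i)) + real_of_ereal (trop_coeff (side (\<not> s') (F ! j)) I')
         \<le> real_of_ereal (y K) + real_of_ereal (trop_coeff (side s' (F ! j)) I)"
        by (rule macaulay_exchange[OF sys' sol' j[unfolded k_def] vI(2) K yK IK dg]) (rule that)
      have "slack a b (Side j s I') = 0"
        by (rule exch[rule_format]) (use I' j in \<open>auto simp: vI(1) s E_def side_gens_def k_def\<close>)
      then show ?thesis using I'(1) s by auto
    qed
  qed
  define x where "x = (\<lambda>i. ereal (a i))"
  have "trop_eval n (side s (F ! j)) x = ereal (b j)" if j: "j < k" for j s
  proof -
    note p = side_is_trop_poly[OF sys, of j s, folded k_def, OF j]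
    have ev: "trop_coeff (side s (F ! j)) I + expo_eval n I x = ereal (b j + slack a b (Side j s I))"
      if "trop_coeff (side s (F ! j)) I \<noteq> \<infinity>" for I
      using that trop_coeff_in[OF p trop_real_subset, of I] expo_eval_real[of n x a I]
      by (cases "trop_coeff (side s (F ! j)) I") (auto simp: slack_def x_def)
    obtain I0 where I0: "trop_coeff (side s (F ! j)) I0 \<noteq> \<infinity>" "slack a b (Side j s I0) = 0"
      using tight[OF j] by blast
    show ?thesis
    proof (rule trop_eval_eqI[OF p])
      show "I0 \<in> dom (side s (F ! j))" using trop_coeff_finite(1)[OF p I0(1)] .
      show "trop_coeff (side s (F ! j)) I0 + expo_eval n I0 x = ereal (b j)" using ev[OF I0(1)] I0(2) by simp
      fix I assume "I \<in> dom (side s (F ! j))"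
      show "ereal (b j) \<le> trop_coeff (side s (F ! j)) I + expo_eval n I x"
      proof (cases "trop_coeff (side s (F ! j)) I = \<infinity>")
        case False
        then have "Side j s I \<in> E" using j by (auto simp: E_def side_gens_def k_def)
        then show ?thesis using ev[OF False] slack by simp
      qed simp
    qed
  qed
  then show ?thesis
    by (intro exI[of _ x] system_rootI) (auto simp: x_def trop_real_def k_def)
qed

section \<open>From solutions to roots over the semiring with infinity\<close>

lemma subset_chain_stationary:
  fixes X :: "nat \<Rightarrow> 'a set"
  assumes "\<And>q. X q \<subseteq> X (Suc q)" "\<And>q. X q \<subseteq> S" "finite S" "card S \<le> m"
  shows "\<exists>q\<le>m. X q = X (Suc q)"
proof (rule ccontr)
  assume no: "\<not> ?thesis"
  have "q \<le> card (X q)" if "q \<le> Suc m" for q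
    using that
  proof (induction q)
    case (Suc q)
    then have "X q \<subset> X (Suc q)" using no assms(1) by auto
    moreover have "finite (X (Suc q))" using assms(2,3) finite_subset by blast
    ultimately have "card (X q) < card (X (Suc q))" by (intro psubset_card_mono)
    then show ?case using Suc by simp
  qed simp
  from this[of "Suc m"] have "Suc m \<le> card (X (Suc m))" by simp
  moreover have "card (X (Suc m)) \<le> card S" by (intro card_mono assms)
  ultimately show False using assms(4) by simp
qed

lemma minplus_degree_le_max: "j < length F \<Longrightarrow> minplus_degree n (F ! j) \<le> max_degree n F"
  unfolding max_degree_def by (intro Max_ge) auto

text \<open>
The bound on \<open>N\<close> leaves room for the rows used by the exchange argument. The representation of \<open>0\<close> by the
generators \<open>Const j\<close> costs \<open>(n + 2) * k * \<kappa>\<close>; an optimal representation of \<open>K\<close> costs at most as much, and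
since each unit of degree not supplied by the groups costs \<open>\<tau>\<close>, the degree of \<open>K\<close> is at most about
\<open>(n + 2) * k * (\<kappa> / \<tau> + d + 1)\<close>.
\<close>

theorem root_of_infinity_solution:
  assumes sys: "minplus_system trop_real_inf n F"
    and d: "d = max_degree n F" "d \<ge> 1" and k: "k = length F" and r: "r = min n k"
    and N: "k * (n + 2) * (d * (4 * d) ^ r + d + 3) + 1 + d \<le> N"
    and sol: "mac_nonhom_solution trop_real_inf n F N y"
  shows "\<exists>x. system_root trop_real_inf n F x"
proof -
  have sol': "mac_solution trop_real_inf n F N y" and y0: "y (\<lambda>_. 0) = 0"
    using sol by (auto simp: mac_nonhom_solution_def)
  note poly = side_is_trop_poly[OF sys, folded k]
  define Y where "Y = (\<lambda>K. real_of_ereal (y K))"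
  define S where "S = {K \<in> mac_cols n N. y K \<noteq> \<infinity>}"
  have finS: "finite S" using finite_mac_cols by (simp add: S_def)
  have fin_sides: "finite (side_gens F)" by (rule finite_side_gens[OF sys])
  \<comment> \<open>The unit of measurement: it exceeds the absolute values of all finite data.\<close>
  define \<tau> where "\<tau> = 1 + (\<Sum>e\<in>side_gens F. \<bar>gen_cost F 0 0 e\<bar>) + (\<Sum>K\<in>S. \<bar>Y K\<bar>)"
  have \<tau>_sums: "(\<Sum>e\<in>side_gens F. \<bar>gen_cost F 0 0 e\<bar>) \<ge> 0" "(\<Sum>K\<in>S. \<bar>Y K\<bar>) \<ge> 0"
    by (intro sum_nonneg; simp)+
  then have \<tau>: "\<tau> \<ge> 1" unfolding \<tau>_def by linarith
  have Y_le: "\<bar>Y K\<bar> \<le> \<tau>" if "K \<in> S" for K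
  proof -
    have "\<bar>Y K\<bar> \<le> (\<Sum>K\<in>S. \<bar>Y K\<bar>)" by (rule member_le_sum) (use that finS in auto)
    then show ?thesis unfolding \<tau>_def using \<tau>_sums by linarith
  qed
  define c where "c = (\<lambda>j s I. real_of_ereal (trop_coeff (side s (F ! j)) I))"
  have c_le: "\<bar>c j s I\<bar> \<le> \<tau>" if "j < k" "trop_coeff (side s (F ! j)) I \<noteq> \<infinity>" for j s I
  proof -
    have "Side j s I \<in> side_gens F" using that by (simp add: side_gens_def k)
    then have "\<bar>gen_cost F 0 0 (Side j s I)\<bar> \<le> (\<Sum>e\<in>side_gens F. \<bar>gen_cost F 0 0 e\<bar>)"
      by (intro member_le_sum) (use fin_sides in auto)
    then have "\<bar>gen_cost F 0 0 (Side j s I)\<bar> \<le> \<tau>" unfolding \<tau>_def using \<tau>_sums by linarith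
    then show ?thesis by (simp add: c_def)
  qed
  have deg_le: "expo_degree n I \<le> d" if "j < k" "trop_coeff (side s (F ! j)) I \<noteq> \<infinity>" for j s I
    using trop_coeff_finite(3)[OF poly[OF that(1)] that(2)] side_degree[of n s "F ! j"]
      minplus_degree_le_max[of j F n] that(1) d(1) k by simp
  \<comment> \<open>Above \<open>\<tau> + d * \<sigma> r\<close>, so that \<open>Const j\<close> is never tight for a pair with a monomial in small variables.\<close>
  define \<kappa> where "\<kappa> = \<tau> * (2 + real d * (4 * real d) ^ r)"
  have \<kappa>0: "\<kappa> \<ge> 0" using \<tau> by (simp add: \<kappa>_def)
  define E where "E = side_gens F \<union> Const ` {..<k} \<union> Unit ` {..<n}"
  interpret weighted_generators E n k "real n + 2" gen_expo "gen_cost F \<kappa> \<tau>" "gen_group k"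
  proof
    show "gen_group k e < k \<or> (\<exists>i<n. 0 < gen_expo e i)" if "e \<in> E" for e
      using that by (auto simp: E_def side_gens_def k)
  qed (use fin_sides in \<open>auto simp: E_def\<close>)
  have E_cases: "(\<exists>j s I. e = Side j s I \<and> j < k \<and> trop_coeff (side s (F ! j)) I \<noteq> \<infinity>) \<or>
      (\<exists>j<k. e = Const j) \<or> (\<exists>i<n. e = Unit i)" if "e \<in> E" for e
    using that by (auto simp: E_def side_gens_def k)
  define w0 where "w0 = (\<lambda>e. (real n + 2) * of_bool (e \<in> Const ` {..<k}))"
  have w0_sum: "(\<Sum>e\<in>E. w0 e * g e) = (real n + 2) * (\<Sum>j<k. g (Const j))" for g
  proof -
    have "(\<Sum>e\<in>E. w0 e * g e) = (\<Sum>e\<in>Const ` {..<k}. w0 e * g e)"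
      by (rule sum.mono_neutral_right) (use finite_E in \<open>auto simp: w0_def E_def\<close>)
    also have "\<dots> = (\<Sum>j<k. (real n + 2) * g (Const j))"
      by (subst sum.reindex) (auto simp: inj_on_def w0_def)
    finally show ?thesis by (simp add: sum_distrib_left)
  qed
  have rep0: "represents w0 (\<lambda>_. 0)"
    unfolding represents_def
  proof (intro conjI ballI allI impI)
    fix r assume "r \<in> rows"
    then show "(\<Sum>e\<in>E. w0 e * entry r e) = rhs (\<lambda>_. 0) r"
      unfolding w0_sum by (auto simp: rows_def entry_def rhs_def)
  qed (auto simp: w0_def E_def)
  have zeroS: "(\<lambda>_. 0) \<in> S" using zero_mac_cols y0 by (simp add: S_def)
  have obj0: "objective Y (\<lambda>_. 0) w0 = (real n + 2) * real k * \<kappa>"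
    by (simp add: objective_def w0_sum Y_def y0)
  obtain K a b where K: "K \<in> S" and slack: "\<forall>e\<in>E. slack a b e \<ge> 0" and b0: "\<forall>j\<ge>k. b j = 0"
    and ex: "\<forall>j<k. \<exists>v w. v \<in> E \<and> gen_group k v = j \<and> slack a b v = 0 \<and> represents w K \<and> w v \<ge> 1 \<and>
       objective Y K w \<le> objective Y (\<lambda>_. 0) w0 \<and>
       (\<forall>i<n. gen_expo v i \<le> K i) \<and>
       (\<forall>e\<in>E. gen_group k e = j \<longrightarrow> (\<lambda>i. K i - gen_expo v i + gen_expo e i) \<in> S \<longrightarrow>
          Y (\<lambda>i. K i - gen_expo v i + gen_expo e i) + gen_cost F \<kappa> \<tau> e
            \<le> Y K + gen_cost F \<kappa> \<tau> v \<longrightarrow> slack a b e = 0)"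
    using exchange_stable_generators[OF finS zeroS rep0, of Y] by (elim exE conjE) (rule that)
  have slack_Side: "slack a b (Side j s I) = c j s I + (\<Sum>i<n. a i * real (I i)) - b j" for j s I
    by (simp add: slack_def c_def)
  have SideE: "Side j s I \<in> E" if "j < k" "trop_coeff (side s (F ! j)) I \<noteq> \<infinity>" for j s I
    using that by (simp add: E_def side_gens_def k)
  have a_ge: "a i \<ge> - \<tau>" if "i < n" for i
  proof -
    have "(\<Sum>i'<n. a i' * real (of_bool (i' = i))) = a i"
      using that by (simp add: of_bool_def if_distrib cong: if_cong)
    moreover have "slack a b (Unit i) \<ge> 0" using slack that by (simp add: E_def)
    ultimately show ?thesis using b0 by (simp add: slack_def)
  qed

  \<comment> \<open>The factor \<open>4 * d\<close> makes one variable above a threshold outweigh a monomial of degree \<open>d\<close> in variables below the preceding one.\<close>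
  define \<sigma> where "\<sigma> = (\<lambda>q. \<tau> * (4 * real d) ^ q)"
  define B where "B = (\<lambda>q. {i. i < n \<and> a i \<le> \<sigma> q})"
  define alive where "alive = (\<lambda>q. {j. j < k \<and>
    (\<exists>s I. trop_coeff (side s (F ! j)) I \<noteq> \<infinity> \<and> (\<forall>i<n. I i > 0 \<longrightarrow> i \<in> B q))})"
  have d1: "real d \<ge> 1" using d(2) by simp
  have \<sigma>_mono: "\<sigma> q \<le> \<sigma> q'" if "q \<le> q'" for q q'
    unfolding \<sigma>_def using that d1 \<tau> by (intro mult_left_mono power_increasing) auto
  have \<sigma>_ge: "\<tau> \<le> \<sigma> q" for q using \<sigma>_mono[of 0 q] by (simp add: \<sigma>_def)
  have B_mono: "B q \<subseteq> B (Suc q)" for q using \<sigma>_mono[of q "Suc q"] by (auto simp: B_def)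
  then have alive_mono: "alive q \<subseteq> alive (Suc q)" for q unfolding alive_def by blast
  have "\<exists>q\<le>r. alive q = alive (Suc q)"
  proof (cases "n \<le> k")
    case True
    have "\<exists>q\<le>r. B q = B (Suc q)"
      by (rule subset_chain_stationary[where S = "{..<n}"]) (use B_mono True r in \<open>auto simp: B_def\<close>)
    then obtain q where "q \<le> r" "B q = B (Suc q)" by blast
    then have "alive q = alive (Suc q)" by (simp only: alive_def)
    then show ?thesis using \<open>q \<le> r\<close> by blast
  next
    case False
    show ?thesis
      by (rule subset_chain_stationary[where S = "{..<k}"]) (use alive_mono False r in \<open>auto simp: alive_def\<close>)
  qed
  then obtain q where q: "q \<le> r" "alive q = alive (Suc q)" by blast
  have b_le: "b j \<le> \<tau> + real d * \<sigma> q" if j: "j \<in> alive q" for j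
  proof -
    obtain s I where I: "j < k" "trop_coeff (side s (F ! j)) I \<noteq> \<infinity>" "\<forall>i<n. I i > 0 \<longrightarrow> i \<in> B q"
      using j by (auto simp: alive_def)
    have "(\<Sum>i<n. a i * real (I i)) \<le> (\<Sum>i<n. \<sigma> q * real (I i))"
    proof (rule sum_mono)
      fix i assume "i \<in> {..<n}"
      then show "a i * real (I i) \<le> \<sigma> q * real (I i)"
        using I(3) by (cases "I i = 0") (auto simp: B_def mult_right_mono)
    qed
    also have "\<dots> = \<sigma> q * real (expo_degree n I)" by (simp add: expo_degree_def sum_distrib_left)
    also have "\<dots> \<le> \<sigma> q * real d"
      using deg_le[OF I(1,2)] \<sigma>_ge[of q] \<tau> by (intro mult_left_mono) auto
    finally show ?thesis
      using slack SideE[OF I(1,2)] c_le[OF I(1,2)] slack_Side[of j s I] by (force simp: mult.commute)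
  qed
  have \<kappa>_gt: "\<tau> + real d * \<sigma> q < \<kappa>"
  proof -
    have "real d * \<sigma> q \<le> real d * \<sigma> r" using \<sigma>_mono[OF q(1)] by (intro mult_left_mono) auto
    moreover have "\<tau> + real d * \<sigma> r < \<kappa>" using \<tau> by (simp add: \<kappa>_def \<sigma>_def algebra_simps)
    ultimately show ?thesis by linarith
  qed
  have tight: "\<exists>I. trop_coeff (side s (F ! j)) I \<noteq> \<infinity> \<and> slack a b (Side j s I) = 0"
    if j: "j \<in> alive q" for j s
  proof -
    have jk: "j < k" using j by (simp add: alive_def)
    obtain v w where v: "v \<in> E" "gen_group k v = j" "slack a b v = 0" and w: "represents w K" "w v \<ge> 1"
      and obj: "objective Y K w \<le> objective Y (\<lambda>_. 0) w0"
      and vK: "\<forall>i<n. gen_expo v i \<le> K i"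
      and exch: "\<forall>e\<in>E. gen_group k e = j \<longrightarrow> (\<lambda>i. K i - gen_expo v i + gen_expo e i) \<in> S \<longrightarrow>
          Y (\<lambda>i. K i - gen_expo v i + gen_expo e i) + gen_cost F \<kappa> \<tau> e
            \<le> Y K + gen_cost F \<kappa> \<tau> v \<longrightarrow> slack a b e = 0"
      using ex[rule_format, OF jk] by (elim exE conjE) (rule that)
    have "v \<noteq> Const j" using v(3) b_le[OF j] \<kappa>_gt by (auto simp: slack_def)
    then obtain s' I where vI: "v = Side j s' I" "trop_coeff (side s' (F ! j)) I \<noteq> \<infinity>"
      using E_cases[OF v(1)] v(2) jk by auto
    show ?thesis
    proof (cases "s = s'")
      case True
      then show ?thesis using vI v by auto
    next
      case False
      then have s: "s = (\<not> s')" by simp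
      have "\<tau> * real (expo_degree n K) \<le>
          (real n + 2) * real k * \<kappa> + \<tau> + (\<tau> * real d + \<tau>) * ((real n + 2) * real k)"
      proof -
        let ?one = "\<lambda>e. \<Sum>j<k. 1 * of_bool (gen_group k e = j) :: real"
        have "\<tau> * real (expo_degree n (gen_expo e)) \<le> gen_cost F \<kappa> \<tau> e + (\<tau> * real d + \<tau>) * ?one e"
          if "e \<in> E" for e
          using E_cases[OF that]
        proof (elim disjE exE conjE)
          fix j s I assume e: "e = Side j s I" and j: "j < k" "trop_coeff (side s (F ! j)) I \<noteq> \<infinity>"
          have "\<tau> * real (expo_degree n I) \<le> \<tau> * real d"
            using deg_le[OF j] \<tau> by (intro mult_left_mono) auto
          moreover have "?one e = 1" using group_sum_single[OF j(1), of e "\<lambda>_. 1"] e by simp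
          moreover have "- \<tau> \<le> c j s I" using c_le[OF j] by linarith
          then have "- \<tau> \<le> gen_cost F \<kappa> \<tau> e" using e by (simp add: c_def)
          ultimately show ?thesis using e by simp
        next
          fix j assume "j < k" "e = Const j"
          moreover have "?one e \<ge> 0" by (intro sum_nonneg) auto
          ultimately show ?thesis using \<kappa>0 \<tau> by (simp add: expo_degree_def)
        next
          fix i assume i: "i < n" "e = Unit i"
          have "expo_degree n (gen_expo e) = 1"
            using i by (simp add: expo_degree_def of_bool_def)
          moreover have "?one e = 0" using i by (intro sum.neutral) auto
          ultimately show ?thesis using i by simp
        qed
        then have "(\<Sum>e\<in>E. w e * (\<tau> * real (expo_degree n (gen_expo e)))) \<le>
            (\<Sum>e\<in>E. w e * (gen_cost F \<kappa> \<tau> e + (\<tau> * real d + \<tau>) * ?one e))"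
          using w(1) by (intro sum_mono mult_left_mono) (auto simp: represents_def)
        also have "\<dots> = (\<Sum>e\<in>E. w e * gen_cost F \<kappa> \<tau> e) + (\<tau> * real d + \<tau>) * (\<Sum>e\<in>E. w e * ?one e)"
          by (simp only: distrib_left sum.distrib sum_distrib_left mult.left_commute)
        also have "(\<Sum>e\<in>E. w e * ?one e) = (real n + 2) * real k"
          by (subst group_weighted_sum[OF w(1)]) simp
        also have "(\<Sum>e\<in>E. w e * gen_cost F \<kappa> \<tau> e) \<le> (real n + 2) * real k * \<kappa> + \<tau>"
          using obj Y_le[OF K] unfolding obj0 by (simp add: objective_def)
        finally show ?thesis
          unfolding represents_degree[OF w(1)] by (simp add: sum_distrib_left mult.left_commute)
      qed
      also have "\<dots> = \<tau> * real (k * (n + 2) * (d * (4 * d) ^ r + d + 3) + 1)"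
        by (simp add: \<kappa>_def algebra_simps)
      finally have "real (expo_degree n K) \<le> real (k * (n + 2) * (d * (4 * d) ^ r + d + 3) + 1)"
        using \<tau> by (simp only: mult_le_cancel_left_pos)
      then have "expo_degree n K + d \<le> N" using N by linarith
      moreover have "expo_degree n (\<lambda>i. K i - I i) \<le> expo_degree n K"
        unfolding expo_degree_def by (rule sum_mono) simp
      moreover have "minplus_degree n (F ! j) \<le> d"
        using minplus_degree_le_max[of j F n] jk d(1) k by simp
      ultimately have dg: "expo_degree n (\<lambda>i. K i - I i) + minplus_degree n (F ! j) \<le> N" by linarith
      have KS: "K \<in> mac_cols n N" "y K \<noteq> \<infinity>" using K by (auto simp: S_def)
      have IK: "\<forall>i<n. I i \<le> K i" using vK vI by simp
      obtain I' where I': "trop_coeff (side (\<not> s') (F ! j)) I' \<noteq> \<infinity>"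
        "(\<lambda>i. K i - I i + I' i) \<in> mac_cols n N" "y (\<lambda>i. K i - I i + I' i) \<noteq> \<infinity>"
        "real_of_ereal (y (\<lambda>i. K i - I i + I' i)) + real_of_ereal (trop_coeff (side (\<not> s') (F ! j)) I')
         \<le> real_of_ereal (y K) + real_of_ereal (trop_coeff (side s' (F ! j)) I)"
        by (rule macaulay_exchange[OF sys sol' jk[unfolded k] vI(2) KS IK dg]) (rule that)
      have "slack a b (Side j s I') = 0"
        by (rule exch[rule_format]) (use I' SideE[OF jk I'(1)] in \<open>auto simp: vI(1) s S_def Y_def\<close>)
      then show ?thesis using I'(1) s by auto
    qed
  qed

  define x where "x = (\<lambda>i. if i \<in> B (Suc q) then ereal (a i) else \<infinity>)"
  \<comment> \<open>A variable above the next threshold contributes more than \<open>4 * d * \<sigma> q\<close>; the other variables of the monomial, being at least \<open>- \<tau>\<close>, cannot bring the value back down to \<open>\<tau> + d * \<sigma> q\<close>.\<close>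
  have tight_in_B: "i \<in> B (Suc q)"
    if j: "j \<in> alive q" and I: "trop_coeff (side s (F ! j)) I \<noteq> \<infinity>" "slack a b (Side j s I) = 0"
      and i: "i < n" "I i > 0" for j s I i
  proof (rule ccontr)
    assume "i \<notin> B (Suc q)"
    then have ai: "a i > 4 * real d * \<sigma> q" using i(1) by (simp add: B_def \<sigma>_def mult_ac)
    have jk: "j < k" using j by (simp add: alive_def)
    have "a i + \<tau> \<le> (a i + \<tau>) * real (I i)"
      using i a_ge[OF i(1)] mult_left_mono[of 1 "real (I i)" "a i + \<tau>"] by simp
    also have "\<dots> \<le> (\<Sum>i<n. (a i + \<tau>) * real (I i))"
    proof (rule member_le_sum)
      fix i' assume "i' \<in> {..<n} - {i}"
      then show "0 \<le> (a i' + \<tau>) * real (I i')" using a_ge[of i'] by simp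
    qed (use i in auto)
    also have "\<dots> = (\<Sum>i<n. a i * real (I i)) + \<tau> * real (expo_degree n I)"
      by (simp add: distrib_right sum.distrib sum_distrib_left expo_degree_def)
    also have "\<dots> \<le> (\<Sum>i<n. a i * real (I i)) + \<tau> * real d"
      using deg_le[OF jk I(1)] \<tau> by (intro add_left_mono mult_left_mono) auto
    finally have "4 * real d * \<sigma> q - \<tau> * real d < c j s I + (\<Sum>i<n. a i * real (I i))"
      using ai c_le[OF jk I(1)] by linarith
    also have "\<dots> = b j" using I(2) slack_Side[of j s I] by simp
    also have "\<dots> \<le> \<tau> + real d * \<sigma> q" by (rule b_le[OF j])
    finally have "3 * (real d * \<sigma> q) < \<tau> + \<tau> * real d" by simp
    moreover have "\<tau> * real d \<le> real d * \<sigma> q"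
      using \<sigma>_ge[of q] d1 mult_left_mono[of \<tau> "\<sigma> q" "real d"] by (simp add: mult.commute)
    moreover have "\<tau> \<le> \<tau> * real d" using \<tau> d1 mult_left_mono[of 1 "real d" \<tau>] by simp
    ultimately show False using \<tau> by linarith
  qed
  have eval_outside: "expo_eval n I x = \<infinity>" if "i < n" "I i > 0" "i \<notin> B (Suc q)" for I i
    by (rule expo_eval_infinite[of i]) (use that in \<open>auto simp: x_def\<close>)
  have eval_inside: "trop_coeff (side s (F ! j)) I + expo_eval n I x = ereal (b j + slack a b (Side j s I))"
    if "j < k" "trop_coeff (side s (F ! j)) I \<noteq> \<infinity>" "\<forall>i<n. I i > 0 \<longrightarrow> i \<in> B (Suc q)" for j s I
  proof -
    have "expo_eval n I x = ereal (\<Sum>i<n. a i * real (I i))"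
      by (rule expo_eval_real) (use that(3) in \<open>auto simp: x_def\<close>)
    then show ?thesis using that(2) trop_coeff_in[OF poly[OF that(1)] order_refl, of s I] slack_Side[of j s I]
      by (cases "trop_coeff (side s (F ! j)) I") (auto simp: c_def)
  qed
  have "trop_eval n (side s (F ! j)) x = (if j \<in> alive q then ereal (b j) else \<infinity>)" if jk: "j < k" for j s
  proof (cases "j \<in> alive q")
    case True
    obtain I0 where I0: "trop_coeff (side s (F ! j)) I0 \<noteq> \<infinity>" "slack a b (Side j s I0) = 0"
      using tight[OF True] by blast
    have "trop_eval n (side s (F ! j)) x = ereal (b j)"
    proof (rule trop_eval_eqI[OF poly[OF jk]])
      show "I0 \<in> dom (side s (F ! j))" using trop_coeff_finite(1)[OF poly[OF jk] I0(1)] .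
      show "trop_coeff (side s (F ! j)) I0 + expo_eval n I0 x = ereal (b j)"
        using eval_inside[OF jk I0(1)] tight_in_B[OF True I0] I0(2) by simp
      fix I assume "I \<in> dom (side s (F ! j))"
      show "ereal (b j) \<le> trop_coeff (side s (F ! j)) I + expo_eval n I x"
      proof (cases "trop_coeff (side s (F ! j)) I = \<infinity> \<or> (\<exists>i<n. I i > 0 \<and> i \<notin> B (Suc q))")
        case True
        then have "trop_coeff (side s (F ! j)) I + expo_eval n I x = \<infinity>" using eval_outside by auto
        then show ?thesis by (simp only: ereal_less_eq(1))
      next
        case False
        then have I: "trop_coeff (side s (F ! j)) I \<noteq> \<infinity>" "\<forall>i<n. I i > 0 \<longrightarrow> i \<in> B (Suc q)" by auto
        show ?thesis using eval_inside[OF jk I] slack SideE[OF jk I(1)] by simp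
      qed
    qed
    then show ?thesis using True by simp
  next
    case False
    have inf: "trop_coeff (side s (F ! j)) I + expo_eval n I x = \<infinity>" for I
    proof (cases "trop_coeff (side s (F ! j)) I = \<infinity>")
      case fin: False
      have "j \<notin> alive (Suc q)" using False q(2) by simp
      then have "\<not> (\<forall>i<n. I i > 0 \<longrightarrow> i \<in> B (Suc q))"
        using jk fin unfolding alive_def mem_Collect_eq by blast
      then obtain i where "i < n" "I i > 0" "i \<notin> B (Suc q)" by blast
      then show ?thesis using eval_outside[of i I] by simp
    qed simp
    have "dom (side s (F ! j)) \<noteq> {}" using poly[OF jk, of s] unfolding is_trop_poly_def by blast
    then obtain I0 where "I0 \<in> dom (side s (F ! j))" by blast
    then have "trop_eval n (side s (F ! j)) x = \<infinity>"
      by (rule trop_eval_eqI[OF poly[OF jk] _ _ inf, rotated]) (simp only: inf order_refl)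
    then show ?thesis using False by simp
  qed
  then have "trop_eval n (side True (F ! j)) x = trop_eval n (side False (F ! j)) x" if "j < k" for j
    using that by simp
  then show ?thesis
    by (intro exI[of _ x] system_rootI) (auto simp: x_def trop_real_inf_iff k)
qed

text \<open>
In degree zero \<open>(4 * d) ^ min n k\<close> can vanish, so \<open>N\<close> can be \<open>0\<close>. All monomials are constants then, and the
rows with \<open>J = 0\<close> compare them directly.
\<close>

lemma root_of_degree_zero_solution:
  assumes sys: "minplus_system trop_real_inf n F" and d: "max_degree n F = 0"
    and sol: "mac_nonhom_solution trop_real_inf n F N y"
  shows "system_root trop_real_inf n F (\<lambda>_. 0)"
proof -
  have sol': "mac_solution trop_real_inf n F N y" and y0: "y (\<lambda>_. 0) = 0"
    using sol by (auto simp: mac_nonhom_solution_def)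
  have deg0: "minplus_degree n (F ! j) = 0" if "j < length F" for j
    using minplus_degree_le_max[OF that, of n] d by simp
  have zero: "I = (\<lambda>_. 0)" if "j < length F" "I \<in> dom (side s (F ! j))" for j s I
  proof -
    note p = side_is_trop_poly[OF sys that(1), of s]
    have "I \<in> expos n" using p that(2) by (auto simp: is_trop_poly_def)
    moreover have "expo_degree n I \<le> trop_degree n (side s (F ! j))"
      unfolding trop_degree_def using that(2) p by (intro Max_ge) (auto simp: is_trop_poly_def)
    then have "expo_degree n I = 0" using side_degree[of n s "F ! j"] deg0[OF that(1)] by simp
    ultimately have "I i = 0" for i by (cases "i < n") (auto simp: expos_def expo_degree_def)
    then show ?thesis by auto
  qed
  have le: "trop_coeff (side (\<not> s) (F ! j)) (\<lambda>_. 0) \<le> trop_coeff (side s (F ! j)) (\<lambda>_. 0)"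
    if j: "j < length F" for j s
  proof (cases "trop_coeff (side s (F ! j)) (\<lambda>_. 0) = \<infinity>")
    case False
    note p = side_is_trop_poly[OF sys j]
    have 1: "y (\<lambda>_. 0) \<noteq> \<infinity>" "\<forall>i<n. (0::nat) \<le> 0" using y0 by auto
    have 2: "expo_degree n (\<lambda>i. 0 - 0) + minplus_degree n (F ! j) \<le> N"
      using deg0[OF j] by (simp add: expo_degree_def)
    obtain I' where I': "trop_coeff (side (\<not> s) (F ! j)) I' \<noteq> \<infinity>"
      "real_of_ereal (y (\<lambda>i. 0 - 0 + I' i)) + real_of_ereal (trop_coeff (side (\<not> s) (F ! j)) I')
         \<le> real_of_ereal (y (\<lambda>_. 0)) + real_of_ereal (trop_coeff (side s (F ! j)) (\<lambda>_. 0))"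
      by (rule macaulay_exchange[OF sys sol' j False zero_mac_cols 1 2]) (rule that)
    have "I' = (\<lambda>_. 0)" using zero[OF j trop_coeff_finite(1)[OF p I'(1)]] .
    then show ?thesis
      using I' False y0 trop_coeff_in[OF p order_refl, of s "\<lambda>_. 0"]
        trop_coeff_in[OF p order_refl, of "\<not> s" "\<lambda>_. 0"]
      by (cases "trop_coeff (side s (F ! j)) (\<lambda>_. 0)"; cases "trop_coeff (side (\<not> s) (F ! j)) (\<lambda>_. 0)") auto
  qed simp
  have ev: "trop_eval n (side s (F ! j)) (\<lambda>_. 0) = trop_coeff (side s (F ! j)) (\<lambda>_. 0)"
    if j: "j < length F" for j s
  proof -
    note p = side_is_trop_poly[OF sys j, of s]
    have e0: "expo_eval n I (\<lambda>_. 0) = 0" for I by (simp add: expo_eval_def)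
    have "dom (side s (F ! j)) \<noteq> {}" using p unfolding is_trop_poly_def by blast
    then obtain I0 where I0: "I0 \<in> dom (side s (F ! j))" by blast
    show ?thesis
    proof (rule trop_eval_eqI[OF p _ I0])
      fix I assume "I \<in> dom (side s (F ! j))"
      then have "I = (\<lambda>_. 0)" by (rule zero[OF j])
      then show "trop_coeff (side s (F ! j)) (\<lambda>_. 0) \<le> trop_coeff (side s (F ! j)) I + expo_eval n I (\<lambda>_. 0)"
        by (simp add: e0)
    next
      have "I0 = (\<lambda>_. 0)" using I0 by (rule zero[OF j])
      then show "trop_coeff (side s (F ! j)) I0 + expo_eval n I0 (\<lambda>_. 0) = trop_coeff (side s (F ! j)) (\<lambda>_. 0)"
        by (simp add: e0)
    qed
  qed
  have "trop_eval n (side True (F ! j)) (\<lambda>_. 0) = trop_eval n (side False (F ! j)) (\<lambda>_. 0)"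
    if "j < length F" for j
    using le[OF that, of True] le[OF that, of False] by (simp add: ev[OF that])
  then show ?thesis by (intro system_rootI) (auto simp: trop_real_inf_iff)
qed

theorem theorem6:
  "(\<forall>n F. minplus_system trop_real n F \<longrightarrow>
      (let N = (n + 2) * (\<Sum>P\<leftarrow>F. minplus_degree n P) in
        (\<exists>x. system_root trop_real n F x) \<longleftrightarrow> (\<exists>y. mac_solution trop_real n F N y)))
   \<and>
   (\<exists>p. \<forall>n k F. length F = k \<longrightarrow> minplus_system trop_real_inf n F \<longrightarrow>
      (let d = max_degree n F; N = poly3 p n k d * (4 * d) ^ min n k in
        (\<exists>x. system_root trop_real_inf n F x) \<longleftrightarrow>
        (\<exists>y. mac_nonhom_solution trop_real_inf n F N y)))"
proof (intro conjI allI impI)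
  fix n F assume sys: "minplus_system trop_real n F"
  have "mac_solution trop_real n F N (\<lambda>I. expo_eval n I x)" if root: "system_root trop_real n F x" for x N
  proof (rule solution_of_root[OF sys trop_real_subset root])
    fix I :: expo
    have "x i = ereal (real_of_ereal (x i)) \<or> I i = 0" if "i < n" for i
      using root that by (cases "x i") (auto simp: system_root_def trop_real_iff)
    then have "expo_eval n I x = ereal (\<Sum>i<n. real_of_ereal (x i) * real (I i))" by (rule expo_eval_real)
    then show "expo_eval n I x \<in> trop_real" by (simp add: trop_real_def)
  qed
  then show "let N = (n + 2) * (\<Sum>P\<leftarrow>F. minplus_degree n P) in
        (\<exists>x. system_root trop_real n F x) \<longleftrightarrow> (\<exists>y. mac_solution trop_real n F N y)"
    using root_of_real_solution[OF sys refl] unfolding Let_def by blast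
next
  \<comment> \<open>The polynomial \<open>k * (n + 2) * (2 * d + 3) + 1 + d\<close>; the outermost variable is \<open>n\<close>, the innermost is \<open>d\<close>.\<close>
  define p :: "nat poly poly poly" where "p = [: [: [:1, 1:], [:6, 4:] :], [: 0, [:3, 2:] :] :]"
  have p: "poly3 p n k d = k * (n + 2) * (2 * d + 3) + 1 + d" for n k d
    by (simp add: p_def poly3_def algebra_simps)
  show "\<exists>p. \<forall>n k F. length F = k \<longrightarrow> minplus_system trop_real_inf n F \<longrightarrow>
      (let d = max_degree n F; N = poly3 p n k d * (4 * d) ^ min n k in
        (\<exists>x. system_root trop_real_inf n F x) \<longleftrightarrow>
        (\<exists>y. mac_nonhom_solution trop_real_inf n F N y))"
  proof (intro exI[of _ p] allI impI)
    fix n k F assume k: "length F = k" and sys: "minplus_system trop_real_inf n F"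
    define d where "d = max_degree n F"
    define N where "N = poly3 p n k d * (4 * d) ^ min n k"
    have "mac_nonhom_solution trop_real_inf n F N (\<lambda>I. expo_eval n I x)"
      if root: "system_root trop_real_inf n F x" for x
    proof -
      have "expo_eval n I x \<in> trop_real_inf" for I
        using expo_eval_not_MInfty[of n x I] root by (auto simp: system_root_def trop_real_inf_iff)
      then have "mac_solution trop_real_inf n F N (\<lambda>I. expo_eval n I x)"
        by (rule solution_of_root[OF sys order_refl root])
      moreover have "expo_eval n (\<lambda>_. 0) x = 0"
        using expo_eval_real[of n x "\<lambda>_. 0" "\<lambda>_. 0"] by (simp add: zero_ereal_def)
      ultimately show ?thesis by (simp add: mac_nonhom_solution_def)
    qed
    moreover have "\<exists>x. system_root trop_real_inf n F x"
      if sol: "mac_nonhom_solution trop_real_inf n F N y" for y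
    proof (cases "d = 0")
      case True
      then show ?thesis using root_of_degree_zero_solution[OF sys _ sol] by (auto simp: d_def)
    next
      case False
      define Q where "Q = (4 * d) ^ min n k"
      have "Q \<ge> 1" using False by (simp add: Q_def)
      then have "(k * (n + 2) * (d + 3) + 1 + d) * 1 \<le> (k * (n + 2) * (d + 3) + 1 + d) * Q"
        by (intro mult_left_mono) auto
      moreover have "N = (k * (n + 2) * (d + 3) + 1 + d) * Q + k * (n + 2) * d * Q"
        by (simp add: N_def p Q_def algebra_simps)
      moreover have "k * (n + 2) * (d * Q + d + 3) + 1 + d =
          (k * (n + 2) * (d + 3) + 1 + d) * 1 + k * (n + 2) * d * Q"
        by (simp add: algebra_simps)
      ultimately have "k * (n + 2) * (d * (4 * d) ^ min n k + d + 3) + 1 + d \<le> N"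
        unfolding Q_def by linarith
      then show ?thesis
        using root_of_infinity_solution[OF sys d_def _ k[symmetric] refl _ sol] False by simp
    qed
    ultimately show "let d = max_degree n F; N = poly3 p n k d * (4 * d) ^ min n k in
        (\<exists>x. system_root trop_real_inf n F x) \<longleftrightarrow> (\<exists>y. mac_nonhom_solution trop_real_inf n F N y)"
      unfolding Let_def d_def[symmetric] N_def[symmetric] by blast
  qed
qed

end
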